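(* Let $w$ be a symmetric weight function on $[-1,1]$, let $0\le\alpha<\pi$ and $\gamma=\cos(\alpha/2)$. Let $P_n$, $Q_n$, $h_n$, $h'_n$ be the monic orthogonal polynomials on $[-1,1]$ for $w(x)$ and $w(x)(1-\gamma^2x^2)$ and their squared norms, as defined in the context. Let $f(\theta)=w(\gamma^{-1}\cos(\theta/2))\sin(\theta/2)$ for $\alpha\le\theta\le 2\pi-\alpha$ and $f(\theta)=0$ for all other $\theta\in[0,2\pi]$, and let $\Phi_n$ and $\chi_n$ be the monic polynomials orthogonal on the unit circle with weight $f$ and the associated constants, as defined in the context. Put $z=e^{i\theta}$, $z^{1/2}=e^{i\theta/2}$, $x=\gamma^{-1}\cos(\theta/2)=(2\gamma)^{-1}(z^{1/2}+z^{-1/2})$. Then: (i) for $n=0,1,\dots$, $$\Phi_n(z)=\frac{(2\gamma)^{n+1}z^{n/2}}{z-1}\left(z^{1/2}P_{n+1}(x)-\frac{P_{n+1}(\gamma^{-1})}{P_n(\gamma^{-1})}P_n(x)\right),\qquad \chi_n^{-2}=(2\gamma)^{2n}\,\frac{\gamma^2}{\pi}\,\frac{P_{n+1}(\gamma^{-1})}{P_n(\gamma^{-1})}\,h_n;$$ (ii) with $$t_k=\frac1{2\pi}\int_\alpha^{2\pi-\alpha}z^{k/2}Q_k(x)f(\theta)\,d\theta,\qquad k=0,1,\dots,$$ one has for $n=1,2,\dots$ $$\Phi_n(z)=(2\gamma)^nz^{n/2}\left(Q_n(x)-z^{-1/2}\frac{t_n}{t_{n-1}}Q_{n-1}(x)\right),\qquad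 \chi_n^{-2}=(2\gamma)^{2n}\,\frac{t_n}{\pi t_{n-1}}\,h'_{n-1};$$ (iii) $\chi_0^{-2}=t_0$.
   Context: A weight function is a nonnegative integrable function that is not almost everywhere zero; $w$ symmetric means $w(x)=w(-x)$. The polynomials $P_n(x)=x^n+\dots$ and $Q_n(x)=x^n+\dots$, $n=0,1,\dots$, are the monic polynomials with $$\int_{-1}^1P_n(x)P_m(x)w(x)\,dx=h_n\delta_{mn},\qquad \int_{-1}^1Q_n(x)Q_m(x)w(x)(1-\gamma^2x^2)\,dx=h'_n\delta_{mn},\qquad m,n=0,1,\dots$$ The polynomials $\Phi_n(z)=z^n+\dots$ are the monic polynomials with $$\frac1{2\pi}\int_0^{2\pi}\Phi_n(e^{i\theta})\overline{\Phi_m(e^{i\theta})}f(\theta)\,d\theta=\frac{\delta_{mn}}{\chi_n^2},\qquad m,n=0,1,\dots$$ Half-integer powers of $z=e^{i\theta}$, $0\le\theta\le2\pi$, are $z^{k/2}=e^{ik\theta/2}$; the formula in (i) with denominator $z-1$ is for $z\ne1$. *)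

theory Defs
  imports "HOL-Analysis.Analysis" "HOL-Computational_Algebra.Polynomial"
begin

definition weight_on :: "real set \<Rightarrow> (real \<Rightarrow> real) \<Rightarrow> bool" where
  "weight_on S w \<longleftrightarrow>
     (\<forall>x\<in>S. 0 \<le> w x) \<and> set_integrable lebesgue S w \<and>
     \<not> (AE x in lebesgue. x \<in> S \<longrightarrow> w x = 0)"

definition monic_poly_seq :: "(nat \<Rightarrow> 'a::comm_semiring_1 poly) \<Rightarrow> bool" where
  "monic_poly_seq p \<longleftrightarrow> (\<forall>n. degree (p n) = n \<and> lead_coeff (p n) = 1)"

definition monic_orth_interval ::
  "(real \<Rightarrow> real) \<Rightarrow> (nat \<Rightarrow> real poly) \<Rightarrow> (nat \<Rightarrow> real) \<Rightarrow> bool" where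
  "monic_orth_interval w p h \<longleftrightarrow> monic_poly_seq p \<and>
     (\<forall>m n. (LINT x:{-1..1}|lebesgue. poly (p n) x * poly (p m) x * w x)
             = (if m = n then h n else 0))"

text \<open>Only \<open>(chi n)\<^sup>2\<close> is determined; \<open>chi n \<noteq> 0\<close> holds automatically when the weight is
  not almost everywhere zero, since \<open>1 / 0 = 0\<close> would give the squared norm \<open>0\<close>.\<close>

definition monic_orth_circle ::
  "(real \<Rightarrow> real) \<Rightarrow> (nat \<Rightarrow> complex poly) \<Rightarrow> (nat \<Rightarrow> real) \<Rightarrow> bool" where
  "monic_orth_circle f \<Phi> chi \<longleftrightarrow> monic_poly_seq \<Phi> \<and>
     (\<forall>m n. complex_of_real (1 / (2 * pi)) *
             (LINT \<theta>:{0..2*pi}|lebesgue.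
                poly (\<Phi> n) (cis \<theta>) * cnj (poly (\<Phi> m) (cis \<theta>)) * complex_of_real (f \<theta>))
             = (if m = n then complex_of_real (1 / (chi n)\<^sup>2) else 0))"

definition arc_weight :: "(real \<Rightarrow> real) \<Rightarrow> real \<Rightarrow> real \<Rightarrow> real" where
  "arc_weight w \<alpha> \<theta> =
     (if \<alpha> \<le> \<theta> \<and> \<theta> \<le> 2 * pi - \<alpha>
      then w (inverse (cos (\<alpha> / 2)) * cos (\<theta> / 2)) * sin (\<theta> / 2) else 0)"

text \<open>Half-integer powers of \<open>z = cis \<theta>\<close> are taken on the branch
  \<open>z\<^bsup>k/2\<^esup> = cis (k \<theta> / 2)\<close>, \<open>0 \<le> \<theta> \<le> 2 \<pi>\<close>; this is not the principal branch.\<close>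

definition arc_moment :: "(real \<Rightarrow> real) \<Rightarrow> real \<Rightarrow> (nat \<Rightarrow> real poly) \<Rightarrow> nat \<Rightarrow> complex" where
  "arc_moment w \<alpha> Q k =
     complex_of_real (1 / (2 * pi)) *
       (LINT \<theta>:{\<alpha>..2*pi - \<alpha>}|lebesgue.
          cis (real k * \<theta> / 2) *
          complex_of_real (poly (Q k) (inverse (cos (\<alpha> / 2)) * cos (\<theta> / 2))) *
          complex_of_real (arc_weight w \<alpha> \<theta>))"

end

theory Submission
  imports Defs
begin

text \<open>Put \<open>u = z\<^bsup>1/2\<^esup>\<close>, a point of the upper unit semicircle with \<open>Re u = \<gamma> x\<close>. The substitution
  \<open>x = \<gamma>\<^bsup>-1\<^esup> cos (\<theta>/2)\<close> turns \<open>f(\<theta>) d\<theta>\<close> into \<open>2 \<gamma> w(x) dx\<close>, and \<open>x \<mapsto> - x\<close> becomes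
  \<open>u \<mapsto> - cnj u\<close>; as \<open>w\<close> is even, for real polynomials only the real part of an inner product on
  the circle survives. By parity \<open>(2 \<gamma> u)\<^sup>n P\<^sub>n(x)\<close> is a monic real polynomial of degree \<open>n\<close> in
  \<open>z = u\<^sup>2\<close>, and likewise for \<open>Q\<^sub>n\<close>, so both right-hand sides are monic of degree \<open>n\<close> in \<open>z\<close>.

  For (i), \<open>z - 1 = 2 i u Im u\<close> and \<open>Im (u\<^sup>m) = Im u \<cdot> U(x)\<close> with \<open>U\<close> a Chebyshev polynomial of
  degree \<open>\<bar>m\<bar> - 1\<close>, so the inner products with \<open>z\<^sup>j\<close> become integrals of \<open>P\<^sub>n\<^sub>+\<^sub>1\<close> and \<open>P\<^sub>n\<close> against
  polynomials of lower degree. For (ii) one tests instead against \<open>z\<^sup>j (z - 1)\<close>, which supplies the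
  factor \<open>(Im u)\<^sup>2 = 1 - \<gamma>\<^sup>2 x\<^sup>2\<close> of the weight of \<open>Q\<^sub>n\<close>, and the quotient \<open>t\<^sub>n / t\<^sub>n\<^sub>-\<^sub>1\<close> is what makes the
  combination orthogonal to \<open>1\<close>. If \<open>t\<^sub>k\<close> vanished, \<open>(2 \<gamma> u)\<^sup>k Q\<^sub>k(x)\<close> would be orthogonal to
  itself.\<close>

section \<open>Weighted integrals over the interval\<close>

text \<open>The codomain is left general so that the real orthogonality relations and the complex
  integrals over the circle are governed by the same lemmas.\<close>

definition weighted_integral :: "(real \<Rightarrow> real) \<Rightarrow> (real \<Rightarrow> 'a) \<Rightarrow> 'a::{banach, second_countable_topology}"
  where "weighted_integral w g = (LINT x:{-1..1}|lebesgue. w x *\<^sub>R g x)"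

lemma weighted_integrable:
  fixes g :: "real \<Rightarrow> 'a::euclidean_space"
  assumes "weight_on {-1..1} w" "continuous_on {-1..1} g"
  shows "set_integrable lebesgue {-1..1} (\<lambda>x. w x *\<^sub>R g x)"
proof (rule absolutely_integrable_bounded_measurable_product[where h = "\<lambda>a b. b *\<^sub>R a"])
  show "bilinear (\<lambda>a b. b *\<^sub>R a :: 'a)"
    by (auto simp: bilinear_def linear_iff scaleR_add_left scaleR_add_right)
  show "g \<in> borel_measurable (lebesgue_on {-1..1})"
    using assms(2) by (intro continuous_imp_measurable_on_sets_lebesgue) auto
  show "bounded (g ` {-1..1})"
    using assms(2) by (intro compact_imp_bounded compact_continuous_image) auto
qed (use assms(1) in \<open>auto simp: weight_on_def\<close>)

lemma weighted_integral_add: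
  fixes g1 g2 :: "real \<Rightarrow> 'a::euclidean_space"
  assumes "weight_on {-1..1} w" "continuous_on {-1..1} g1" "continuous_on {-1..1} g2"
  shows "weighted_integral w (\<lambda>x. g1 x + g2 x) = weighted_integral w g1 + weighted_integral w g2"
  unfolding weighted_integral_def scaleR_add_right
  by (intro set_integral_add weighted_integrable assms)

lemma weighted_integral_diff:
  fixes g1 g2 :: "real \<Rightarrow> 'a::euclidean_space"
  assumes "weight_on {-1..1} w" "continuous_on {-1..1} g1" "continuous_on {-1..1} g2"
  shows "weighted_integral w (\<lambda>x. g1 x - g2 x) = weighted_integral w g1 - weighted_integral w g2"
  unfolding weighted_integral_def scaleR_diff_right
  by (intro set_integral_diff weighted_integrable assms)

lemma weighted_integral_cmult [simp]:
  fixes c :: "'a::{real_normed_field, banach, second_countable_topology}"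
  shows "weighted_integral w (\<lambda>x. c * g x) = c * weighted_integral w g"
proof -
  have "w x *\<^sub>R (c * g x) = c * (w x *\<^sub>R g x)" for x by simp
  then show ?thesis
    unfolding weighted_integral_def by (simp only: set_integral_mult_right)
qed

lemma weighted_integral_of_real:
  "weighted_integral w (\<lambda>x. complex_of_real (g x)) = of_real (weighted_integral w g)"
  unfolding weighted_integral_def set_integral_complex_of_real[symmetric]
  by (simp add: scaleR_conv_of_real)

text \<open>Endpoints form a null set. Leaving them out matters for \<gamma> = 1, where the
  imaginary part of the half-angle point vanishes at x = 1 and x = -1 and cannot be cancelled
  there.\<close>

lemma weighted_integral_cong:
  fixes g1 g2 :: "real \<Rightarrow> 'a::euclidean_space"
  assumes "\<And>x. x \<in> {-1<..<1} \<Longrightarrow> g1 x = g2 x"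
  shows "weighted_integral w g1 = weighted_integral w g2"
proof -
  have open_eq: "weighted_integral w g = (LINT x:{-1<..<1}|lebesgue. w x *\<^sub>R g x)"
    for g :: "real \<Rightarrow> 'a"
    unfolding weighted_integral_def
    by (rule set_integral_discrete_difference[where X = "{-1, 1}"]) auto
  show ?thesis
    unfolding open_eq by (rule set_lebesgue_integral_cong) (auto simp: assms)
qed

lemma weighted_integral_reflect:
  fixes g :: "real \<Rightarrow> 'a::euclidean_space"
  assumes "\<forall>x\<in>{-1..1}. w x = w (- x)"
  shows "weighted_integral w (\<lambda>x. g (- x)) = weighted_integral w g"
proof -
  have on: "weighted_integral w f = integral\<^sup>L (lebesgue_on {-1..1}) (\<lambda>x. w x *\<^sub>R f x)"
    for f :: "real \<Rightarrow> 'a"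
    unfolding weighted_integral_def set_lebesgue_integral_def
    by (simp add: integral_restrict_space)
  have "integral\<^sup>L (lebesgue_on {-1..1}) (\<lambda>x. w x *\<^sub>R g (- x))
      = integral\<^sup>L (lebesgue_on {-1..1}) (\<lambda>x. w (- x) *\<^sub>R g (- x))"
  proof (rule Bochner_Integration.integral_cong)
    fix x :: real assume "x \<in> space (lebesgue_on {-1..1})"
    with assms have "w x = w (- x)" by (simp only: space_lebesgue_on)
    then show "w x *\<^sub>R g (- x) = w (- x) *\<^sub>R g (- x)" by (rule arg_cong)
  qed simp
  also have "\<dots> = integral\<^sup>L (lebesgue_on {-1..1}) (\<lambda>x. w x *\<^sub>R g x)"
    using integral_reflect_real[of 1 "-1" "\<lambda>x. w x *\<^sub>R g x"] by simp
  finally show ?thesis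
    by (simp add: on)
qed

text \<open>Were the integral zero, the nonnegative product of \<open>w\<close> and \<open>g\<close>
  would vanish almost everywhere; off the finitely many zeros of \<open>g\<close> this forces
  \<open>w\<close> to vanish almost everywhere, which \<open>weight_on\<close> excludes.\<close>

lemma weighted_integral_pos:
  fixes g :: "real \<Rightarrow> real"
  assumes w: "weight_on {-1..1} w" and g: "continuous_on {-1..1} g"
    and nonneg: "\<And>x. x \<in> {-1..1} \<Longrightarrow> 0 \<le> g x" and fin: "finite {x\<in>{-1..1}. g x = 0}"
  shows "0 < weighted_integral w g"
proof -
  have wn: "0 \<le> w x" if "x \<in> {-1..1}" for x
    using w that by (auto simp: weight_on_def)
  have int: "integrable lebesgue (\<lambda>x. indicator {-1..1} x *\<^sub>R (w x *\<^sub>R g x))"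
    using weighted_integrable[OF w g] unfolding set_integrable_def .
  have ge: "0 \<le> indicator {-1..1} x *\<^sub>R (w x *\<^sub>R g x)" for x
    using wn nonneg by (auto simp: indicator_def)
  have "weighted_integral w g \<noteq> 0"
  proof
    assume "weighted_integral w g = 0"
    then have ae: "AE x in lebesgue. indicator {-1..1} x *\<^sub>R (w x *\<^sub>R g x) = 0"
      using integral_nonneg_eq_0_iff_AE[OF int] ge
      unfolding weighted_integral_def set_lebesgue_integral_def by simp
    have "AE x in lebesgue. x \<notin> {x\<in>{-1..1}. g x = 0}"
      by (rule AE_not_in) (intro negligible_iff_null_sets[THEN iffD1] negligible_finite fin)
    with ae have "AE x in lebesgue. x \<in> {-1..1} \<longrightarrow> w x = 0"
      by eventually_elim (auto simp: indicator_def split: if_splits)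
    with w show False by (simp add: weight_on_def)
  qed
  moreover have "0 \<le> weighted_integral w g"
    unfolding weighted_integral_def set_lebesgue_integral_def
    using ge by (intro integral_nonneg_AE) auto
  ultimately show ?thesis by simp
qed

lemma weight_on_mult:
  assumes w: "weight_on {-1..1} w" and v: "continuous_on {-1..1} v"
    and nonneg: "\<And>x. x \<in> {-1..1} \<Longrightarrow> 0 \<le> v x" and fin: "finite {x\<in>{-1..1}. v x = 0}"
  shows "weight_on {-1..1} (\<lambda>x. w x * v x)"
  unfolding weight_on_def
proof (intro conjI ballI notI)
  show "0 \<le> w x * v x" if "x \<in> {-1..1}" for x
    using w that nonneg by (auto simp: weight_on_def)
  show "set_integrable lebesgue {-1..1} (\<lambda>x. w x * v x)"
    using weighted_integrable[OF w v] by simp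
  assume "AE x in lebesgue. x \<in> {-1..1} \<longrightarrow> w x * v x = 0"
  moreover have "AE x in lebesgue. x \<notin> {x\<in>{-1..1}. v x = 0}"
    by (rule AE_not_in) (intro negligible_iff_null_sets[THEN iffD1] negligible_finite fin)
  ultimately have "AE x in lebesgue. x \<in> {-1..1} \<longrightarrow> w x = 0"
    by eventually_elim auto
  with w show False by (simp add: weight_on_def)
qed

section \<open>Orthogonal polynomials on the interval\<close>

text \<open>Subtracting \<open>coeff q N\<close> times \<open>p N\<close> lowers the degree bound by
  one, so a linear property of the first \<open>N\<close> members passes to every polynomial of
  degree below \<open>N\<close>. Stating the bound by vanishing coefficients lets
  \<open>N = 0\<close> mean \<open>q = 0\<close>.\<close>

lemma monic_poly_seq_span:
  fixes p :: "nat \<Rightarrow> 'a::comm_ring_1 poly"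
  assumes "monic_poly_seq p"
    and zero: "Z 0" and add: "\<And>q r. Z q \<Longrightarrow> Z r \<Longrightarrow> Z (q + r)"
    and smult: "\<And>c q. Z q \<Longrightarrow> Z (smult c q)"
    and base: "\<And>i. i < N \<Longrightarrow> Z (p i)" and deg: "\<And>i. N \<le> i \<Longrightarrow> coeff q i = 0"
  shows "Z q"
  using base deg
proof (induction N arbitrary: q)
  case 0
  then have "q = 0" by (intro poly_eqI) simp
  then show ?case using zero by simp
next
  case (Suc N)
  let ?r = "q - smult (coeff q N) (p N)"
  have "coeff (p N) N = 1" "degree (p N) = N"
    using assms(1) unfolding monic_poly_seq_def by metis+
  then have r0: "coeff ?r i = 0" if "N \<le> i" for i
    using that Suc.prems(2)[of i] by (cases "i = N") (auto simp: coeff_eq_0)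
  have "Z ?r"
  proof (rule Suc.IH)
    show "Z (p i)" if "i < N" for i
      using that by (intro Suc.prems(1)) simp
  qed (rule r0)
  then have "Z (?r + smult (coeff q N) (p N))"
    by (intro add smult Suc.prems(1)) simp_all
  then show ?case by simp
qed

lemma monic_poly_seqD:
  assumes "monic_poly_seq p"
  shows "degree (p n) = n" "coeff (p n) n = 1" "p n \<noteq> 0"
  using assms unfolding monic_poly_seq_def by (metis, metis, metis coeff_0 zero_neq_one)

lemma orth_intervalD:
  assumes "monic_orth_interval W P h"
  shows "monic_poly_seq P"
    and "weighted_integral W (\<lambda>x. poly (P n) x * poly (P m) x) = (if m = n then h n else 0)"
  using assms by (auto simp: monic_orth_interval_def weighted_integral_def mult_ac)

text \<open>Removing \<open>coeff q n\<close> times \<open>P n\<close> from \<open>q\<close> leaves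
  a polynomial of degree below \<open>n\<close>, which is orthogonal to \<open>P n\<close>. This
  serves both for vanishing integrals and for those that produce \<open>h n\<close>.\<close>

lemma orth_interval_coeff:
  assumes W: "weight_on {-1..1} W" and P: "monic_orth_interval W P h"
    and deg: "\<And>i. n < i \<Longrightarrow> coeff q i = 0"
  shows "weighted_integral W (\<lambda>x. poly (P n) x * poly q x) = coeff q n * h n"
proof -
  let ?Z = "\<lambda>r. weighted_integral W (\<lambda>x. poly (P n) x * poly r x) = 0"
  note monic = monic_poly_seqD[OF orth_intervalD(1)[OF P]]
  have "?Z (q - smult (coeff q n) (P n))"
  proof (rule monic_poly_seq_span[OF orth_intervalD(1)[OF P], where N = n])
    show "?Z 0"
      using weighted_integral_cmult[of W 0 "\<lambda>x. 0 :: real"] by simp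
    show "?Z (q + r)" if "?Z q" "?Z r" for q r
      using that W by (simp add: distrib_left weighted_integral_add continuous_intros)
    show "?Z (smult c q)" if "?Z q" for c q
      using that weighted_integral_cmult[of W c "\<lambda>x. poly (P n) x * poly q x"]
      by (simp add: mult.left_commute)
    show "?Z (P i)" if "i < n" for i
      using that orth_intervalD(2)[OF P, of n i] by simp
    show "coeff (q - smult (coeff q n) (P n)) i = 0" if "n \<le> i" for i
      using that monic[of n] deg[of i] by (cases "i = n") (auto simp: coeff_eq_0)
  qed
  moreover have "weighted_integral W (\<lambda>x. poly (P n) x * poly (q - smult (coeff q n) (P n)) x)
      = weighted_integral W (\<lambda>x. poly (P n) x * poly q x)
        - weighted_integral W (\<lambda>x. coeff q n * (poly (P n) x * poly (P n) x))"
    using W by (subst weighted_integral_diff[symmetric])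
      (auto simp: algebra_simps intro!: continuous_intros)
  ultimately show ?thesis
    using orth_intervalD(2)[OF P, of n n] by simp
qed

text \<open>The difference of two candidates has degree below \<open>n\<close> and is orthogonal to
  both, hence to itself, so positivity makes it zero.\<close>

lemma orth_interval_unique:
  assumes W: "weight_on {-1..1} W" and P: "monic_orth_interval W P h"
    and p: "degree p = n" "lead_coeff p = 1"
    and orth: "\<And>q. (\<And>i. n \<le> i \<Longrightarrow> coeff q i = 0) \<Longrightarrow> weighted_integral W (\<lambda>x. poly p x * poly q x) = 0"
  shows "p = P n"
proof (rule ccontr)
  assume "p \<noteq> P n"
  define d where "d = P n - p"
  note monic = monic_poly_seqD[OF orth_intervalD(1)[OF P], of n]
  have d0: "coeff d i = 0" if "n \<le> i" for i
    using that monic p by (cases "i = n") (auto simp: coeff_eq_0 d_def)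
  have "weighted_integral W (\<lambda>x. poly d x * poly d x)
      = weighted_integral W (\<lambda>x. poly (P n) x * poly d x) - weighted_integral W (\<lambda>x. poly p x * poly d x)"
    using W by (subst weighted_integral_diff[symmetric])
      (auto simp: d_def algebra_simps intro!: continuous_intros)
  also have "\<dots> = 0"
    using orth_interval_coeff[OF W P, of n d] orth[of d] d0 by simp
  finally have "weighted_integral W (\<lambda>x. poly d x * poly d x) = 0" .
  moreover have "0 < weighted_integral W (\<lambda>x. poly d x * poly d x)"
  proof (intro weighted_integral_pos W)
    show "finite {x\<in>{-1..1}. poly d x * poly d x = 0}"
      by (rule finite_subset[OF _ poly_roots_finite[of d]]) (use \<open>p \<noteq> P n\<close> in \<open>auto simp: d_def\<close>)
  qed (auto intro!: continuous_intros)
  ultimately show False by simp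
qed

text \<open>For an even weight, (-1)^n P_n(-x) is again monic of degree n and orthogonal to all
  lower degrees, so uniqueness applies.\<close>

lemma orth_interval_parity:
  assumes W: "weight_on {-1..1} W" and P: "monic_orth_interval W P h"
    and sym: "\<forall>x\<in>{-1..1}. W x = W (- x)"
  shows "poly (P n) (- x) = (-1) ^ n * poly (P n) x"
proof -
  note monic = monic_poly_seqD[OF orth_intervalD(1)[OF P], of n]
  define p where "p = smult ((-1) ^ n) (pcompose (P n) [:0, -1:])"
  have "p = P n"
  proof (rule orth_interval_unique[OF W P])
    show "degree p = n"
      by (simp add: p_def monic degree_pcompose)
    then show "lead_coeff p = 1"
      by (simp add: p_def coeff_pcompose_linear monic flip: power_mult_distrib)
    fix q :: "real poly" assume q: "\<And>i. n \<le> i \<Longrightarrow> coeff q i = 0"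
    let ?q = "pcompose q [:0, -1:]"
    have "weighted_integral W (\<lambda>x. poly p x * poly q x)
        = weighted_integral W (\<lambda>x. poly p (- x) * poly q (- x))"
      using weighted_integral_reflect[OF sym, of "\<lambda>x. poly p x * poly q x"] by simp
    also have "(\<lambda>x. poly p (- x) * poly q (- x)) = (\<lambda>x. (-1) ^ n * (poly (P n) x * poly ?q x))"
      by (simp add: p_def poly_pcompose mult.assoc)
    also have "weighted_integral W \<dots> = 0"
      using orth_interval_coeff[OF W P, of n ?q] q by (simp add: coeff_pcompose_linear)
    finally show "weighted_integral W (\<lambda>x. poly p x * poly q x) = 0" .
  qed
  then have "poly p (- x) = poly (P n) (- x)" by simp
  then show ?thesis by (simp add: p_def poly_pcompose)
qed

text \<open>A root y \<ge> 1 would split off as P_n = (x - y) r with deg r < n; then P_n would be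
  orthogonal to -r, although the integrand (y - x) r^2 has positive integral. With y = 1/\<gamma>
  this justifies dividing by \<open>poly (P n) (inverse \<gamma>)\<close>, and y = 1 covers \<alpha>
  = 0.\<close>

lemma orth_interval_nonzero:
  assumes W: "weight_on {-1..1} W" and P: "monic_orth_interval W P h" and y: "1 \<le> y"
  shows "poly (P n) y \<noteq> 0"
proof
  assume "poly (P n) y = 0"
  then obtain r where r: "P n = [:- y, 1:] * r"
    by (auto simp: poly_eq_0_iff_dvd dvd_def)
  note monic = monic_poly_seqD[OF orth_intervalD(1)[OF P], of n]
  have "r \<noteq> 0" using r monic(3) by auto
  then have "n = Suc (degree r)"
    using r monic(1) by (simp add: degree_mult_eq del: mult_pCons_left)
  then have "weighted_integral W (\<lambda>x. poly (P n) x * poly (- r) x) = 0"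
    using orth_interval_coeff[OF W P, of n "- r"] by (simp add: coeff_eq_0)
  moreover have "(\<lambda>x. poly (P n) x * poly (- r) x) = (\<lambda>x. (y - x) * (poly r x)\<^sup>2)"
    by (simp add: r fun_eq_iff algebra_simps power2_eq_square)
  moreover have "0 < weighted_integral W (\<lambda>x. (y - x) * (poly r x)\<^sup>2)"
  proof (intro weighted_integral_pos W)
    have "{x\<in>{-1..1}. (y - x) * (poly r x)\<^sup>2 = 0} \<subseteq> {y} \<union> {x. poly r x = 0}" by auto
    then show "finite {x\<in>{-1..1}. (y - x) * (poly r x)\<^sup>2 = 0}"
      by (rule finite_subset) (simp add: poly_roots_finite \<open>r \<noteq> 0\<close>)
  qed (use y in \<open>auto intro!: continuous_intros mult_nonneg_nonneg\<close>)
  ultimately show False by simp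
qed

section \<open>Chebyshev polynomials and half-integer powers\<close>

abbreviation cpoly :: "real poly \<Rightarrow> complex poly" where
  "cpoly \<equiv> map_poly complex_of_real"

lemma coeff_cpoly [simp]: "coeff (cpoly p) i = of_real (coeff p i)"
  by (simp add: coeff_map_poly)

lemma degree_cpoly [simp]: "degree (cpoly p) = degree p"
  by (simp add: degree_map_poly)

lemma cpoly_diff: "cpoly (p - q) = cpoly p - cpoly q"
  by (intro poly_eqI) simp

lemma cpoly_smult: "cpoly (smult c p) = smult (of_real c) (cpoly p)"
  by (intro poly_eqI) simp

lemma cpoly_sum: "cpoly (sum f A) = (\<Sum>i\<in>A. cpoly (f i))"
  by (intro poly_eqI) (simp add: coeff_sum)

lemma cpoly_mult: "cpoly (p * q) = cpoly p * cpoly q"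
  by (intro poly_eqI) (simp add: coeff_mult)

lemma cpoly_power: "cpoly (p ^ n) = cpoly p ^ n"
  by (induction n) (simp_all add: cpoly_mult)

lemma cnj_poly_cpoly: "cnj (poly (cpoly p) z) = poly (cpoly p) (cnj z)"
  by (rule poly_cnj_real) simp

text \<open>The Chebyshev polynomial of the second kind of index n - 1 in the argument c x. The
  shift puts sin (n \<phi>) / sin \<phi> at index \<open>n\<close>, and the scaling makes cos \<phi>
  / c the variable.\<close>

fun chebyshev :: "real \<Rightarrow> nat \<Rightarrow> real poly" where
  "chebyshev c 0 = 0"
| "chebyshev c (Suc 0) = 1"
| "chebyshev c (Suc (Suc n)) = [:0, 2 * c:] * chebyshev c (Suc n) - chebyshev c n"

text \<open>A unit \<open>v\<close> satisfies v^2 = 2 (Re v) v - 1, so its powers, and with them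
  their imaginary parts, obey the Chebyshev recurrence.\<close>

lemma Im_power_chebyshev:
  assumes "norm v = 1" "c \<noteq> 0"
  shows "Im (v ^ n) = Im v * poly (chebyshev c n) (Re v / c)"
  using assms(2)
proof (induction c n rule: chebyshev.induct)
  case (3 c n)
  have "v * v = of_real (2 * Re v) * v - 1"
    using assms(1) by (simp add: complex_eq_iff cmod_def power2_eq_square algebra_simps)
  then have "v ^ Suc (Suc n) = of_real (2 * Re v) * v ^ Suc n - v ^ n"
    unfolding power_Suc mult.assoc[symmetric] by (simp only: left_diff_distrib mult_1)
  then have "Im (v ^ Suc (Suc n)) = 2 * Re v * Im (v ^ Suc n) - Im (v ^ n)"
    by (simp del: power_Suc)
  also have "\<dots> = Im v * poly (chebyshev c (Suc (Suc n))) (Re v / c)"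
    unfolding 3(1)[OF 3(3)] 3(2)[OF 3(3)] using 3(3) by (simp add: right_diff_distrib)
  finally show ?case .
qed auto

lemma coeff_chebyshev_eq_0: "n \<le> i \<Longrightarrow> coeff (chebyshev c n) i = 0"
proof (induction c n arbitrary: i rule: chebyshev.induct)
  case (3 c n)
  then show ?case
    by (cases i) (simp_all add: coeff_pCons)
qed (auto simp: coeff_1)

lemma coeff_chebyshev_top: "coeff (chebyshev c (Suc n)) n = (2 * c) ^ n"
proof (induction n)
  case (Suc n)
  then show ?case
    by (simp add: coeff_chebyshev_eq_0)
qed simp

text \<open>Chebyshev polynomials of the second kind in the variable \<open>cos \<phi> / c\<close>, extended to negative indices by
  oddness, so that they represent \<open>sin (m \<phi>) / sin \<phi>\<close> for every integer \<open>m\<close>.\<close>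

definition int_chebyshev :: "real \<Rightarrow> int \<Rightarrow> real poly" where
  "int_chebyshev c m = (if 0 \<le> m then chebyshev c (nat m) else - chebyshev c (nat (- m)))"

lemma inverse_eq_cnj_unit: "norm v = 1 \<Longrightarrow> inverse v = cnj v"
  by (simp add: inverse_complex_def complex_eq_iff cmod_def)

lemma Im_powi_chebyshev:
  assumes "norm v = 1" "c \<noteq> 0"
  shows "Im (v powi m) = Im v * poly (int_chebyshev c m) (Re v / c)"
proof (cases "0 \<le> m")
  case True
  then show ?thesis
    using Im_power_chebyshev[OF assms, of "nat m"] by (simp add: int_chebyshev_def power_int_def)
next
  case False
  then have "v powi m = cnj (v ^ nat (- m))"
    using inverse_eq_cnj_unit[OF assms(1)] by (simp add: power_int_def)
  then show ?thesis
    using Im_power_chebyshev[OF assms, of "nat (- m)"] False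
    by (simp add: int_chebyshev_def del: complex_cnj_power)
qed

lemma coeff_int_chebyshev_eq_0: "\<bar>m\<bar> \<le> int i \<Longrightarrow> coeff (int_chebyshev c m) i = 0"
  by (auto simp: int_chebyshev_def coeff_chebyshev_eq_0)

text \<open>Among the indices n - 1 - 2j with 0 \<le> j \<le> n, only j = n gives a polynomial
  reaching degree n. Its sign is negative because the index is.\<close>

lemma coeff_int_chebyshev_bottom: "coeff (int_chebyshev c (- int n - 1)) n = - ((2 * c) ^ n)"
proof -
  have "nat (1 + int n) = Suc n" by simp
  then show ?thesis
    by (simp add: int_chebyshev_def coeff_chebyshev_top)
qed

lemma power_mult_cnj_power:
  assumes "norm v = 1"
  shows "v ^ a * cnj v ^ b = v powi (int a - int b)"
proof -
  have "v \<noteq> 0" using assms by auto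
  then show ?thesis
    using inverse_eq_cnj_unit[OF assms]
    by (simp add: power_int_diff divide_inverse flip: power_inverse)
qed

text \<open>Since 1 = v * cnj v, the left side is v (v - cnj v).\<close>

lemma power2_minus_1_unit:
  assumes "norm v = 1"
  shows "v\<^sup>2 - 1 = 2 * \<i> * of_real (Im v) * v"
  using assms by (simp add: complex_eq_iff cmod_def power2_eq_square algebra_simps)

text \<open>Parity leaves only monomials x^i with n - i even. As 2 (Re v) v = 1 + v^2 on the unit
  circle, (2c)^n v^n (Re v / c)^i equals (2c)^(n-i) z^((n-i)/2) (1 + z)^i with z = v^2, a polynomial
  in z with real coefficients.\<close>

lemma exists_half_power_poly:
  fixes p :: "real poly"
  assumes "c \<noteq> 0" "degree p = n" "lead_coeff p = 1" and parity: "\<And>x. poly p (- x) = (-1) ^ n * poly p x"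
  shows "\<exists>a. degree a = n \<and> lead_coeff a = 1 \<and> (\<forall>v. norm v = 1 \<longrightarrow>
           poly (cpoly a) (v\<^sup>2) = of_real ((2 * c) ^ n) * v ^ n * of_real (poly p (Re v / c)))"
proof -
  let ?t = "\<lambda>i. monom 1 ((n - i) div 2) * [:1, 1:] ^ i :: real poly"
  let ?s = "\<lambda>i. smult (coeff p i * (2 * c) ^ (n - i)) (?t i)"
  define a where "a = (\<Sum>i\<le>n. ?s i)"
  have odd0: "coeff p i = 0" if "i \<le> n" "odd (n - i)" for i
  proof -
    have "pcompose p [:0, -1:] = smult ((-1) ^ n) p"
      by (simp add: poly_pcompose parity poly_eq_poly_eq_iff[symmetric] fun_eq_iff)
    then have "(-1) ^ i * coeff p i = (-1) ^ n * coeff p i"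
      by (metis coeff_pcompose_linear coeff_smult)
    moreover have "(-1::real) ^ n = - ((-1) ^ i)"
      using that by (cases "even i") (auto simp: minus_one_power_iff)
    ultimately show ?thesis
      by (cases "even i") auto
  qed
  have top: "coeff ([:1, 1:] ^ i :: real poly) i = 1" for i
    using lead_coeff_power[of "[:1, 1:] :: real poly" i]
    unfolding degree_linear_power by simp
  \<comment> \<open>For n - i even, \<open>?t i\<close> has degree (n + i)/2, which is below n
    unless i = n. For n - i odd the rounding in \<open>div\<close> is harmless, because
    \<open>coeff p i\<close> vanishes.\<close>
  have coeff_s: "coeff (?s i) m = (if i = n \<and> m = n then 1 else 0)" if "i \<le> n" "n \<le> m" for i m
  proof -
    have le: "degree (?t i) \<le> (n - i) div 2 + i"
      using degree_mult_le[of "monom 1 ((n - i) div 2)" "[:1, 1:] ^ i :: real poly"]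
      unfolding degree_linear_power degree_monom_eq[OF one_neq_zero] .
    show ?thesis
    proof (cases "i = n")
      case True
      then have s: "?s i = [:1, 1:] ^ n"
        using assms(2,3) by (simp add: monom_0)
      show ?thesis
      proof (cases "m = n")
        case True
        then show ?thesis unfolding s using top[of n] \<open>i = n\<close> by simp
      next
        case False
        then have "degree ([:1, 1:] ^ n :: real poly) < m"
          unfolding degree_linear_power using that by simp
        then show ?thesis unfolding s using False by (simp add: coeff_eq_0)
      qed
    next
      case False
      show ?thesis
      proof (cases "odd (n - i)")
        case True
        then show ?thesis using odd0 that False by simp
      next
        case even: False
        then have "(n - i) div 2 + i < n" using False that by presburger
        then have "coeff (?t i) m = 0" using le that by (intro coeff_eq_0) linarith
        then show ?thesis using False by simp
      qed
    qed
  qed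
  have coeff_a: "coeff a m = (if m = n then 1 else 0)" if "n \<le> m" for m
  proof -
    have "coeff a m = (\<Sum>i\<le>n. if i = n then if m = n then 1 else 0 else 0)"
      unfolding a_def coeff_sum
    proof (intro sum.cong refl)
      fix i assume "i \<in> {..n}"
      then have "coeff (?s i) m = (if i = n \<and> m = n then 1 else 0)"
        by (intro coeff_s that) simp
      then show "coeff (?s i) m = (if i = n then if m = n then 1 else 0 else 0)"
        by presburger
    qed
    then show ?thesis by simp
  qed
  have "degree a = n"
  proof (rule antisym)
    show "degree a \<le> n" by (rule degree_le) (simp add: coeff_a)
    show "n \<le> degree a" by (rule le_degree) (simp add: coeff_a)
  qed
  have "poly (cpoly a) (v\<^sup>2) = of_real ((2 * c) ^ n) * v ^ n * of_real (poly p (Re v / c))"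
    if "norm v = 1" for v
  proof -
    have v2: "1 + v\<^sup>2 = of_real (2 * Re v) * v"
      using that by (simp add: complex_eq_iff cmod_def power2_eq_square algebra_simps)
    have "poly (cpoly (?s i)) (v\<^sup>2)
        = of_real ((2 * c) ^ n) * v ^ n * of_real (coeff p i * (Re v / c) ^ i)" if "i \<le> n" for i
    proof (cases "odd (n - i)")
      case True
      then show ?thesis using odd0 that by simp
    next
      case False
      have "poly (cpoly (?s i)) (v\<^sup>2)
          = of_real (coeff p i * (2 * c) ^ (n - i)) * (v ^ (n - i) * (1 + v\<^sup>2) ^ i)"
        using False by (simp add: cpoly_smult cpoly_mult cpoly_power map_poly_monom map_poly_pCons
            poly_monom flip: power_mult)
      also have "\<dots> = of_real (coeff p i * (2 * c) ^ (n - i) * (2 * Re v) ^ i) * (v ^ (n - i) * v ^ i)"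
        unfolding v2 by (simp add: power_mult_distrib)
      also have "v ^ (n - i) * v ^ i = v ^ n"
        using that by (simp flip: power_add)
      also have "(2 * Re v) ^ i = (2 * c) ^ i * (Re v / c) ^ i"
        unfolding power_mult_distrib[symmetric] using assms(1) by simp
      also have "coeff p i * (2 * c) ^ (n - i) * ((2 * c) ^ i * (Re v / c) ^ i)
          = ((2 * c) ^ (n - i) * (2 * c) ^ i) * (coeff p i * (Re v / c) ^ i)"
        by (simp only: mult_ac)
      also have "(2 * c) ^ (n - i) * (2 * c) ^ i = (2 * c) ^ n"
        unfolding power_add[symmetric] using that by simp
      finally show ?thesis by simp
    qed
    then have "poly (cpoly a) (v\<^sup>2)
        = (\<Sum>i\<le>n. of_real ((2 * c) ^ n) * v ^ n * of_real (coeff p i * (Re v / c) ^ i))"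
      unfolding a_def cpoly_sum poly_sum by (intro sum.cong) auto
    also have "\<dots> = of_real ((2 * c) ^ n) * v ^ n * of_real (poly p (Re v / c))"
      unfolding poly_altdef[of p] assms(2) of_real_sum sum_distrib_left by (rule refl)
    finally show ?thesis .
  qed
  moreover have "lead_coeff a = 1"
    unfolding \<open>degree a = n\<close> by (simp add: coeff_a)
  ultimately show ?thesis
    using \<open>degree a = n\<close> by blast
qed

section \<open>Integrals over the arc\<close>

text \<open>The point of the upper unit semicircle playing the role of \<open>z\<^bsup>1/2\<^esup>\<close>.\<close>

definition half_point :: "real \<Rightarrow> real \<Rightarrow> complex" where
  "half_point \<gamma> x = Complex (\<gamma> * x) (sqrt (1 - \<gamma>\<^sup>2 * x\<^sup>2))"

lemma continuous_on_half_point: "continuous_on S (half_point \<gamma>)"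
proof -
  have "half_point \<gamma> = (\<lambda>x. of_real (\<gamma> * x) + \<i> * of_real (sqrt (1 - \<gamma>\<^sup>2 * x\<^sup>2)))"
    by (simp add: fun_eq_iff half_point_def complex_eq_iff)
  then show ?thesis
    by (simp only:) (intro continuous_intros)
qed

lemma half_point_minus: "half_point \<gamma> (- x) = - cnj (half_point \<gamma> x)"
  by (simp add: half_point_def complex_eq_iff)

lemma half_point_norm:
  assumes "\<bar>\<gamma>\<bar> \<le> 1" "x \<in> {-1..1}"
  shows "norm (half_point \<gamma> x) = 1" and "\<gamma>\<^sup>2 * x\<^sup>2 \<le> 1"
proof -
  have "\<bar>\<gamma> * x\<bar> \<le> 1 * 1"
    unfolding abs_mult using assms by (intro mult_mono) auto
  then have "(\<gamma> * x)\<^sup>2 \<le> 1"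
    by (simp add: abs_square_le_1)
  then show *: "\<gamma>\<^sup>2 * x\<^sup>2 \<le> 1"
    by (simp add: power_mult_distrib)
  show "norm (half_point \<gamma> x) = 1"
    using * by (simp add: half_point_def cmod_def power_mult_distrib)
qed

lemma half_point_Im_pos:
  assumes "\<bar>\<gamma>\<bar> \<le> 1" "x \<in> {-1<..<1}"
  shows "0 < Im (half_point \<gamma> x)"
proof -
  have "\<bar>\<gamma>\<bar> * \<bar>x\<bar> \<le> 1 * \<bar>x\<bar>"
    using assms by (intro mult_right_mono) auto
  also have "\<dots> < 1" using assms by auto
  finally have "(\<gamma> * x)\<^sup>2 < 1"
    by (simp add: abs_mult abs_square_less_1)
  then show ?thesis
    by (simp add: half_point_def power_mult_distrib)
qed

lemma Re_half_point [simp]: "Re (half_point \<gamma> x) = \<gamma> * x"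
  and Im_half_point: "Im (half_point \<gamma> x) = sqrt (1 - \<gamma>\<^sup>2 * x\<^sup>2)"
  by (simp_all add: half_point_def)

text \<open>The integral over the arc as a function of v = z^(1/2), already pulled back to x; the
  Jacobian constant 2\<gamma> is left out and restored by \<open>arc_integral\<close>.\<close>

definition circle_integral :: "(real \<Rightarrow> real) \<Rightarrow> real \<Rightarrow> (complex \<Rightarrow> complex) \<Rightarrow> complex" where
  "circle_integral w \<gamma> G = weighted_integral w (\<lambda>x. G (half_point \<gamma> x))"

locale symmetric_arc =
  fixes w :: "real \<Rightarrow> real" and \<alpha> \<gamma> :: real
  assumes weight: "weight_on {-1..1} w"
    and even_weight: "\<forall>x\<in>{-1..1}. w x = w (- x)"
    and alpha: "0 \<le> \<alpha>" "\<alpha> < pi" and gamma: "\<gamma> = cos (\<alpha> / 2)"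
begin

lemma gamma_pos: "0 < \<gamma>" and gamma_le_1: "\<gamma> \<le> 1"
  using alpha unfolding gamma by (auto intro!: cos_gt_zero_pi)

lemma continuous_on_circle:
  assumes "continuous_on (sphere 0 1) G"
  shows "continuous_on {-1..1} (\<lambda>x. G (half_point \<gamma> x))"
  using gamma_pos gamma_le_1
  by (intro continuous_on_compose2[OF assms continuous_on_half_point]) (auto simp: half_point_norm)

text \<open>For x = cos (\<theta>/2) / \<gamma> one has |dx/d\<theta>| = sin (\<theta>/2) /
  (2\<gamma>), so the factor sin (\<theta>/2) in the arc weight is absorbed and 2\<gamma>
  remains.\<close>

lemma arc_integral:
  assumes "continuous_on (sphere 0 1) G"
  shows "(LINT \<theta>:{\<alpha>..2*pi - \<alpha>}|lebesgue. G (cis (\<theta> / 2)) * complex_of_real (arc_weight w \<alpha> \<theta>))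
       = of_real (2 * \<gamma>) * circle_integral w \<gamma> G"
proof -
  let ?S = "{\<alpha>..2*pi - \<alpha>}" and ?g = "\<lambda>\<theta>. inverse \<gamma> * cos (\<theta> / 2)"
  let ?h = "\<lambda>\<theta>. - (inverse \<gamma> * sin (\<theta> / 2) / 2)"
  let ?f = "\<lambda>x. of_real (2 * \<gamma>) * (w x *\<^sub>R G (half_point \<gamma> x))"
  have half_in: "\<theta> / 2 \<in> {0..pi}" if "\<theta> \<in> ?S" for \<theta>
    using that alpha by auto
  have sin_ge: "0 \<le> sin (\<theta> / 2)" if "\<theta> \<in> ?S" for \<theta>
    using half_in[OF that] by (auto intro: sin_ge_zero)
  have inj: "inj_on ?g ?S"
  proof (rule inj_onI)
    fix a b assume "a \<in> ?S" "b \<in> ?S" "?g a = ?g b"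
    then show "a = b"
      using half_in[of a] half_in[of b] gamma_pos cos_inj_pi[of "a/2" "b/2"] by auto
  qed
  \<comment> \<open>The half angle runs from \<alpha>/2 to pi - \<alpha>/2, where its cosine is
    \<gamma> and -\<gamma>.\<close>
  have "?g ` ?S = {-1..1}"
  proof (intro equalityI subsetI)
    fix x assume "x \<in> ?g ` ?S"
    then obtain \<theta> where t: "\<theta> \<in> ?S" "x = ?g \<theta>" by auto
    have "cos (\<theta> / 2) \<le> \<gamma>"
      unfolding gamma using t alpha by (intro cos_monotone_0_pi_le) auto
    moreover have "cos (pi - \<alpha> / 2) \<le> cos (\<theta> / 2)"
      using t alpha by (intro cos_monotone_0_pi_le) auto
    then have "- \<gamma> \<le> cos (\<theta> / 2)"
      by (simp add: gamma cos_diff)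
    ultimately show "x \<in> {-1..1}"
      using gamma_pos by (auto simp: t field_simps)
  next
    fix x :: real assume x: "x \<in> {-1..1}"
    have "\<gamma> * (-1) \<le> \<gamma> * x" "\<gamma> * x \<le> \<gamma> * 1"
      by (intro mult_left_mono; use x gamma_pos in simp)+
    then have gx: "- \<gamma> \<le> \<gamma> * x" "\<gamma> * x \<le> \<gamma>" "-1 \<le> \<gamma> * x" "\<gamma> * x \<le> 1"
      using gamma_le_1 by linarith+
    have "\<alpha> / 2 = arccos \<gamma>"
      unfolding gamma using alpha by (intro arccos_cos[symmetric]) auto
    moreover have "pi - \<alpha> / 2 = arccos (- \<gamma>)"
      using arccos_minus[of \<gamma>] gamma_pos gamma_le_1 \<open>\<alpha> / 2 = arccos \<gamma>\<close> by simp
    moreover have "arccos \<gamma> \<le> arccos (\<gamma> * x)" "arccos (\<gamma> * x) \<le> arccos (- \<gamma>)"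
      using gx gamma_pos gamma_le_1 by (auto intro!: arccos_le_arccos)
    ultimately have "2 * arccos (\<gamma> * x) \<in> ?S"
      by auto
    moreover have "?g (2 * arccos (\<gamma> * x)) = x"
      using gx gamma_pos by (simp add: cos_arccos)
    ultimately show "x \<in> ?g ` ?S" by (metis image_eqI)
  qed
  moreover have "?f absolutely_integrable_on {-1..1}"
    by (intro set_integrable_mult_right weighted_integrable weight continuous_on_circle assms)
  \<comment> \<open>The substitution rule is an equivalence. With the value on
    \<open>{-1..1}\<close> as target, its right side holds once the image is known, and its left
    side gives integrability and value together.\<close>
  moreover have "(\<lambda>x. \<bar>?h x\<bar> *\<^sub>R ?f (?g x)) absolutely_integrable_on ?S \<and>
      integral ?S (\<lambda>x. \<bar>?h x\<bar> *\<^sub>R ?f (?g x)) = integral {-1..1} ?f \<longleftrightarrow>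
      ?f absolutely_integrable_on (?g ` ?S) \<and> integral (?g ` ?S) ?f = integral {-1..1} ?f"
    using inj gamma_pos
    by (intro has_absolute_integral_change_of_variables_real) (auto intro!: derivative_eq_intros)
  ultimately have int: "(\<lambda>x. \<bar>?h x\<bar> *\<^sub>R ?f (?g x)) absolutely_integrable_on ?S"
    and eq: "integral ?S (\<lambda>x. \<bar>?h x\<bar> *\<^sub>R ?f (?g x)) = integral {-1..1} ?f"
    and fint: "?f absolutely_integrable_on {-1..1}"
    by simp_all
  have "\<bar>?h \<theta>\<bar> *\<^sub>R ?f (?g \<theta>) = G (cis (\<theta> / 2)) * complex_of_real (arc_weight w \<alpha> \<theta>)"
    if "\<theta> \<in> ?S" for \<theta>
  proof -
    have gx: "\<gamma> * ?g \<theta> = cos (\<theta> / 2)"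
      using gamma_pos by simp
    have "1 - \<gamma>\<^sup>2 * (?g \<theta>)\<^sup>2 = (sin (\<theta> / 2))\<^sup>2"
      unfolding power_mult_distrib[symmetric] gx by (simp only: sin_squared_eq)
    \<comment> \<open>On the arc sin (\<theta>/2) is nonnegative, so the square root in
      \<open>half_point\<close> is the sine itself, with no sign ambiguity.\<close>
    then have "half_point \<gamma> (?g \<theta>) = cis (\<theta> / 2)"
      using sin_ge[OF that] gx unfolding half_point_def by (simp add: complex_eq_iff)
    moreover have "arc_weight w \<alpha> \<theta> = w (?g \<theta>) * sin (\<theta> / 2)"
      using that by (simp add: arc_weight_def gamma)
    moreover have "\<bar>?h \<theta>\<bar> * (2 * \<gamma>) = sin (\<theta> / 2)"
      using gamma_pos sin_ge[OF that] by (simp add: abs_mult)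
    moreover have "r *\<^sub>R (complex_of_real s * (a *\<^sub>R b)) = b * of_real (a * (r * s))" for r s a b
      by (simp add: scaleR_conv_of_real)
    ultimately show ?thesis
      by (simp only:)
  qed
  then have "(LINT \<theta>:?S|lebesgue. G (cis (\<theta> / 2)) * complex_of_real (arc_weight w \<alpha> \<theta>))
      = (LINT \<theta>:?S|lebesgue. \<bar>?h \<theta>\<bar> *\<^sub>R ?f (?g \<theta>))"
    by (intro set_lebesgue_integral_cong) auto
  also have "\<dots> = (LINT x:{-1..1}|lebesgue. ?f x)"
    by (simp only: set_lebesgue_integral_eq_integral(2)[OF int] eq
        set_lebesgue_integral_eq_integral(2)[OF fint])
  also have "\<dots> = of_real (2 * \<gamma>) * circle_integral w \<gamma> G"
    by (simp only: set_integral_mult_right circle_integral_def weighted_integral_def)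
  finally show ?thesis .
qed

lemma full_circle_integral:
  assumes "continuous_on (sphere 0 1) G"
  shows "(LINT \<theta>:{0..2*pi}|lebesgue. G (cis (\<theta> / 2)) * complex_of_real (arc_weight w \<alpha> \<theta>))
       = of_real (2 * \<gamma>) * circle_integral w \<gamma> G"
proof -
  have "(LINT \<theta>:{0..2*pi}|lebesgue. G (cis (\<theta> / 2)) * complex_of_real (arc_weight w \<alpha> \<theta>))
      = (LINT \<theta>:{\<alpha>..2*pi - \<alpha>}|lebesgue. G (cis (\<theta> / 2)) * complex_of_real (arc_weight w \<alpha> \<theta>))"
    unfolding set_lebesgue_integral_def using alpha
    by (intro Bochner_Integration.integral_cong) (auto simp: indicator_def arc_weight_def)
  then show ?thesis
    using arc_integral[OF assms] by simp
qed

end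

section \<open>The Hermitian form of the arc weight on polynomials in z\<close>

context symmetric_arc
begin

lemma norm_half_point: "x \<in> {-1..1} \<Longrightarrow> norm (half_point \<gamma> x) = 1"
  using half_point_norm(1)[of \<gamma> x] gamma_pos gamma_le_1 by simp

lemma circle_integral_add:
  assumes "continuous_on (sphere 0 1) G" "continuous_on (sphere 0 1) H"
  shows "circle_integral w \<gamma> (\<lambda>v. G v + H v) = circle_integral w \<gamma> G + circle_integral w \<gamma> H"
  unfolding circle_integral_def
  by (intro weighted_integral_add weight continuous_on_circle assms)

lemma circle_integral_cmult [simp]:
  "circle_integral w \<gamma> (\<lambda>v. c * G v) = c * circle_integral w \<gamma> G"
  by (simp add: circle_integral_def)

lemma circle_integral_reflect:
  "circle_integral w \<gamma> (\<lambda>v. G (- cnj v)) = circle_integral w \<gamma> G"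
  using weighted_integral_reflect[OF even_weight, of "\<lambda>x. G (half_point \<gamma> x)"]
  by (simp add: circle_integral_def half_point_minus)

text \<open>Reflection preserves the integral and conjugates the integrand, so twice the integral is
  that of \<open>G v + cnj (G v)\<close>. Polynomials in v^2 with real coefficients meet the
  hypothesis.\<close>

lemma circle_integral_real:
  assumes G: "continuous_on (sphere 0 1) G" and "\<And>v. G (- cnj v) = cnj (G v)"
  shows "circle_integral w \<gamma> G = of_real (weighted_integral w (\<lambda>x. Re (G (half_point \<gamma> x))))"
proof -
  have "2 * circle_integral w \<gamma> G = circle_integral w \<gamma> G + circle_integral w \<gamma> (\<lambda>v. cnj (G v))"
    using circle_integral_reflect[of G] assms(2) by simp
  also have "\<dots> = circle_integral w \<gamma> (\<lambda>v. G v + cnj (G v))"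
    by (intro circle_integral_add[symmetric] continuous_intros G)
  also have "\<dots> = 2 * circle_integral w \<gamma> (\<lambda>v. of_real (Re (G v)))"
    unfolding circle_integral_cmult[symmetric] by (simp add: complex_add_cnj)
  also have "circle_integral w \<gamma> (\<lambda>v. of_real (Re (G v)))
      = of_real (weighted_integral w (\<lambda>x. Re (G (half_point \<gamma> x))))"
    by (simp add: circle_integral_def weighted_integral_of_real)
  finally show ?thesis by simp
qed

text \<open>The inner product of the circle weight up to a constant: the normalisation 1/(2 pi) and
  the Jacobian 2\<gamma> combine to \<gamma>/pi.\<close>

definition arc_form :: "complex poly \<Rightarrow> complex poly \<Rightarrow> complex" where
  "arc_form p q = circle_integral w \<gamma> (\<lambda>v. poly p (v\<^sup>2) * cnj (poly q (v\<^sup>2)))"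

lemma arc_form_add_right: "arc_form p (q + r) = arc_form p q + arc_form p r"
  unfolding arc_form_def poly_add complex_cnj_add distrib_left
  by (intro circle_integral_add continuous_intros)

lemma arc_form_add_left: "arc_form (p + q) r = arc_form p r + arc_form q r"
  unfolding arc_form_def poly_add distrib_right
  by (intro circle_integral_add continuous_intros)

lemma arc_form_smult_left: "arc_form (smult c p) q = c * arc_form p q"
  by (simp add: arc_form_def mult.assoc)

lemma arc_form_smult_right: "arc_form p (smult c q) = cnj c * arc_form p q"
  by (simp add: arc_form_def mult.left_commute[of _ "cnj c"])

lemma arc_form_diff_left: "arc_form (p - q) r = arc_form p r - arc_form q r"
  using arc_form_add_left[of p "smult (-1) q" r] unfolding arc_form_smult_left by simp

lemma arc_form_diff_right: "arc_form p (q - r) = arc_form p q - arc_form p r"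
  using arc_form_add_right[of p q "smult (-1) r"] unfolding arc_form_smult_right by simp

lemma arc_form_zero_right [simp]: "arc_form p 0 = 0"
  using arc_form_smult_right[of p 0 0] by simp

text \<open>The integrand is |p(v^2)|^2, which has finitely many zeros in x because x is recovered
  from Re v = \<gamma> x.\<close>

lemma arc_form_self_nonzero:
  assumes "p \<noteq> 0"
  shows "arc_form p p \<noteq> 0"
proof -
  let ?g = "\<lambda>x. (norm (poly p ((half_point \<gamma> x)\<^sup>2)))\<^sup>2"
  have "arc_form p p = of_real (weighted_integral w ?g)"
    unfolding arc_form_def circle_integral_def weighted_integral_of_real[symmetric]
    by (simp only: complex_norm_square)
  moreover have "0 < weighted_integral w ?g"
  proof (intro weighted_integral_pos weight)
    let ?q = "pcompose p [:0, 0, 1:]"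
    have "?q \<noteq> 0"
      using assms by (subst pcompose_eq_0_iff) auto
    have "inj (half_point \<gamma>)"
      using gamma_pos by (auto simp: inj_def half_point_def)
    then have "finite (half_point \<gamma> -` {z. poly ?q z = 0})"
      by (intro finite_vimageI poly_roots_finite \<open>?q \<noteq> 0\<close>)
    then show "finite {x\<in>{-1..1}. ?g x = 0}"
      by (rule rev_finite_subset) (auto simp: poly_pcompose power2_eq_square)
  qed (auto intro!: continuous_intros continuous_on_half_point)
  ultimately show ?thesis by simp
qed

lemma arc_form_span_zero:
  assumes "monic_poly_seq e" "\<And>i. i < n \<Longrightarrow> arc_form p (e i) = 0" "\<And>i. n \<le> i \<Longrightarrow> coeff q i = 0"
  shows "arc_form p q = 0"
proof (rule monic_poly_seq_span[OF assms(1), where Z = "\<lambda>q. arc_form p q = 0" and N = n])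
qed (simp_all only: arc_form_zero_right arc_form_add_right arc_form_smult_right assms(2,3) mult_zero_right add_0)

lemma orth_circle_arc_form:
  assumes "monic_orth_circle (arc_weight w \<alpha>) \<Phi> chi"
  shows "of_real (\<gamma> / pi) * arc_form (\<Phi> n) (\<Phi> m) = (if m = n then of_real (1 / (chi n)\<^sup>2) else 0)"
proof -
  let ?G = "\<lambda>v. poly (\<Phi> n) (v\<^sup>2) * cnj (poly (\<Phi> m) (v\<^sup>2))"
  have sq: "(cis (\<theta> / 2))\<^sup>2 = cis \<theta>" for \<theta>
    by (simp add: power2_eq_square cis_mult)
  have "complex_of_real (1 / (2 * pi)) * (LINT \<theta>:{0..2*pi}|lebesgue.
          ?G (cis (\<theta> / 2)) * complex_of_real (arc_weight w \<alpha> \<theta>))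
      = (if m = n then of_real (1 / (chi n)\<^sup>2) else 0)"
    unfolding sq using assms by (simp add: monic_orth_circle_def)
  moreover have "complex_of_real (1 / (2 * pi)) * (of_real (2 * \<gamma>) * arc_form (\<Phi> n) (\<Phi> m))
      = of_real (\<gamma> / pi) * arc_form (\<Phi> n) (\<Phi> m)"
    by simp
  moreover have "(LINT \<theta>:{0..2*pi}|lebesgue. ?G (cis (\<theta> / 2)) * complex_of_real (arc_weight w \<alpha> \<theta>))
      = of_real (2 * \<gamma>) * arc_form (\<Phi> n) (\<Phi> m)"
    unfolding arc_form_def by (rule full_circle_integral) (intro continuous_intros)
  ultimately show ?thesis by simp
qed

text \<open>The difference of \<open>\<Phi> n\<close> and \<open>S\<close> has lower degree and is
  orthogonal to itself. The norm needs only one pairing with \<open>e n\<close>, as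
  \<open>e n\<close> and \<open>\<Phi> n\<close> differ by lower degree. The test sequence
  \<open>e\<close> is free, so each representation can use the one that suits it.\<close>

lemma orth_circle_unique:
  assumes \<Phi>: "monic_orth_circle (arc_weight w \<alpha>) \<Phi> chi" and e: "monic_poly_seq e"
    and S: "degree S = n" "lead_coeff S = 1" and orth: "\<And>j. j < n \<Longrightarrow> arc_form S (e j) = 0"
  shows "\<Phi> n = S" and "of_real (1 / (chi n)\<^sup>2) = of_real (\<gamma> / pi) * arc_form S (e n)"
proof -
  have mon: "monic_poly_seq \<Phi>"
    using \<Phi> by (simp add: monic_orth_circle_def)
  have \<Phi>0: "arc_form (\<Phi> n) q = 0" if "\<And>i. n \<le> i \<Longrightarrow> coeff q i = 0" for q
  proof (rule arc_form_span_zero[OF mon _ that])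
    show "arc_form (\<Phi> n) (\<Phi> i) = 0" if "i < n" for i
      using orth_circle_arc_form[OF \<Phi>, of n i] that gamma_pos by simp
  qed
  have monic_diff: "coeff (p - q) i = 0"
    if "n \<le> i" "degree p = n" "lead_coeff p = 1" "degree q = n" "lead_coeff q = 1"
    for p q :: "complex poly" and i
    using that by (cases "i = n") (auto simp: coeff_eq_0)
  have \<Phi>n: "degree (\<Phi> n) = n" "lead_coeff (\<Phi> n) = 1" and en: "degree (e n) = n" "lead_coeff (e n) = 1"
    using mon e unfolding monic_poly_seq_def by blast+
  have d0: "coeff (\<Phi> n - S) i = 0" if "n \<le> i" for i
    by (rule monic_diff[OF that \<Phi>n S])
  have "arc_form (\<Phi> n) (\<Phi> n - S) = 0"
    by (rule \<Phi>0) (rule d0)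
  moreover have "arc_form S (\<Phi> n - S) = 0"
    by (rule arc_form_span_zero[OF e]) (fact orth d0)+
  ultimately have "arc_form (\<Phi> n - S) (\<Phi> n - S) = 0"
    using arc_form_diff_left[of "\<Phi> n" S "\<Phi> n - S"] by simp
  then show eq: "\<Phi> n = S"
    using arc_form_self_nonzero[of "\<Phi> n - S"] by auto
  have "arc_form (\<Phi> n) (e n - \<Phi> n) = 0"
    by (rule \<Phi>0) (rule monic_diff[OF _ en \<Phi>n])
  then have "arc_form (\<Phi> n) (e n) = arc_form (\<Phi> n) (\<Phi> n)"
    by (simp add: arc_form_diff_right)
  then show "of_real (1 / (chi n)\<^sup>2) = of_real (\<gamma> / pi) * arc_form S (e n)"
    using orth_circle_arc_form[OF \<Phi>, of n n] eq by simp
qed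

lemma arc_form_cpoly:
  "arc_form (cpoly p) (cpoly q) = of_real (weighted_integral w (\<lambda>x.
     Re (poly (cpoly p) ((half_point \<gamma> x)\<^sup>2) * cnj (poly (cpoly q) ((half_point \<gamma> x)\<^sup>2)))))"
  unfolding arc_form_def
  by (rule circle_integral_real) (auto intro!: continuous_intros simp: cnj_poly_cpoly)

end

section \<open>The two representations\<close>

text \<open>The test sequence 1, z - 1, z (z - 1), ... for the second representation: every member
  after the first carries the factor z - 1.\<close>

lemma monic_poly_seq_shifted_powers:
  "monic_poly_seq (\<lambda>i. cpoly (case i of 0 \<Rightarrow> 1 | Suc j \<Rightarrow> monom 1 j * [:-1, 1:]))"
proof -
  have "degree (monom 1 j * [:-1, 1:] :: real poly) = Suc j" for j
    by (subst degree_mult_eq) (simp_all add: degree_monom_eq)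
  moreover have "lead_coeff (monom 1 j * [:-1, 1:] :: real poly) = 1" for j
    unfolding lead_coeff_mult by (simp add: degree_monom_eq)
  ultimately show ?thesis
    unfolding monic_poly_seq_def degree_cpoly coeff_cpoly by (auto split: nat.split)
qed

section \<open>The representation through \<open>P\<close>\<close>

context symmetric_arc
begin

lemma Re_half_point_div: "Re (half_point \<gamma> x) / \<gamma> = x"
  using gamma_pos by simp

lemma circle_integral_cong:
  assumes "\<And>v. norm v = 1 \<Longrightarrow> G v = H v"
  shows "circle_integral w \<gamma> G = circle_integral w \<gamma> H"
  unfolding circle_integral_def
  by (rule weighted_integral_cong) (simp add: assms norm_half_point)

text \<open>Here \<open>s\<close> is the value at z = v^2 of the quotient by z - 1. Multiplying by 2
  i Im v turns the real part into an imaginary part and clears the denominator; the Chebyshev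
  formula then returns a factor Im v, which cancels.\<close>

lemma Re_quotient_kernel:
  assumes v: "norm v = 1" "Im v \<noteq> 0"
    and S: "(v\<^sup>2 - 1) * s = of_real K * (v ^ (n + 1) * of_real A) - of_real (K * c) * (v ^ n * of_real B)"
  shows "Re (s * cnj ((v\<^sup>2) ^ j)) = K / 2 *
           (A * poly (int_chebyshev \<gamma> (int n - 2 * int j)) (Re v / \<gamma>)
            - c * (B * poly (int_chebyshev \<gamma> (int n - 1 - 2 * int j)) (Re v / \<gamma>)))"
    (is "?lhs = K / 2 * (A * ?U1 - c * (B * ?U2))")
proof -
  note cheb = Im_powi_chebyshev[OF v(1) gamma_pos[THEN less_imp_neq, symmetric]]
  have Im_diff: "Im (of_real a * y - of_real b * z) = a * Im y - b * Im z" for a b y z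
    by simp
  have "cnj v * v = 1"
    using v(1) inverse_eq_cnj_unit[OF v(1)] by (metis left_inverse norm_zero zero_neq_one)
  \<comment> \<open>Inserting v * cnj v = 1 completes 2 i Im v to v^2 - 1, at the cost of one more
    factor cnj v.\<close>
  then have "2 * \<i> * of_real (Im v) * (s * cnj ((v\<^sup>2) ^ j))
      = (2 * \<i> * of_real (Im v) * v) * s * cnj v ^ (2 * j + 1)"
    by (simp add: power_mult[symmetric] mult_ac)
  also have "\<dots> = (of_real K * (v ^ (n + 1) * of_real A) - of_real (K * c) * (v ^ n * of_real B)) * cnj v ^ (2 * j + 1)"
    unfolding power2_minus_1_unit[OF v(1), symmetric] S ..
  also have "\<dots> = of_real (K * A) * (v ^ (n + 1) * cnj v ^ (2 * j + 1))
      - of_real (K * c * B) * (v ^ n * cnj v ^ (2 * j + 1))"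
    by (simp only: left_diff_distrib right_diff_distrib of_real_mult mult_ac)
  also have "\<dots> = of_real (K * A) * (v powi (int n - 2 * int j))
      - of_real (K * c * B) * (v powi (int n - 1 - 2 * int j))"
    unfolding power_mult_cnj_power[OF v(1)] by (simp add: algebra_simps)
  finally have "Im (2 * \<i> * of_real (Im v) * (s * cnj ((v\<^sup>2) ^ j)))
      = K * A * (Im v * ?U1) - K * c * B * (Im v * ?U2)"
    by (simp only: Im_diff cheb)
  moreover have "Im (2 * \<i> * of_real (Im v) * (s * cnj ((v\<^sup>2) ^ j))) = 2 * Im v * ?lhs"
    by (simp add: mult.assoc del: complex_cnj_power)
  ultimately have "Im v * ?lhs = Im v * (K / 2 * (A * ?U1 - c * (B * ?U2)))"
    by (simp add: algebra_simps)
  then show ?thesis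
    using v(2) by simp
qed

text \<open>The ratio \<open>c\<close> makes the numerator vanish at z = 1, that is at x =
  1/\<gamma>, so division by z - 1 leaves a monic polynomial of degree \<open>n\<close>. The
  identity is kept multiplied by v^2 - 1, hence needs no exception at z = 1.\<close>

lemma first_representation:
  assumes P: "monic_orth_interval w P h" and \<Phi>: "monic_orth_circle (arc_weight w \<alpha>) \<Phi> chi"
    and c: "c = poly (P (n + 1)) (inverse \<gamma>) / poly (P n) (inverse \<gamma>)"
  shows "norm v = 1 \<Longrightarrow> (v\<^sup>2 - 1) * poly (\<Phi> n) (v\<^sup>2) = of_real ((2 * \<gamma>) ^ (n + 1)) * v ^ n *
           (v * of_real (poly (P (n + 1)) (Re v / \<gamma>)) - of_real (c * poly (P n) (Re v / \<gamma>)))"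
    and "1 / (chi n)\<^sup>2 = (2 * \<gamma>) ^ (2 * n) * (\<gamma>\<^sup>2 / pi) * c * h n"
proof -
  note monic = monic_poly_seqD[OF orth_intervalD(1)[OF P]]
  have "\<exists>a. degree a = n \<and> lead_coeff a = 1 \<and> (\<forall>v. norm v = 1 \<longrightarrow>
      poly (cpoly a) (v\<^sup>2) = of_real ((2 * \<gamma>) ^ n) * v ^ n * of_real (poly (P n) (Re v / \<gamma>)))" for n
    using gamma_pos monic orth_interval_parity[OF weight P even_weight]
    by (intro exists_half_power_poly) auto
  then obtain a where a: "\<And>n. degree (a n) = n" "\<And>n. lead_coeff (a n) = 1"
    and eval: "\<And>n v. norm v = 1 \<Longrightarrow> poly (cpoly (a n)) (v\<^sup>2)
      = of_real ((2 * \<gamma>) ^ n) * v ^ n * of_real (poly (P n) (Re v / \<gamma>))"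
    by metis
  let ?K = "(2 * \<gamma>) ^ (n + 1)"
  \<comment> \<open>The numerator as a polynomial in z; the factor 2\<gamma> compensates for the
    different powers of 2\<gamma> contained in \<open>a (n + 1)\<close> and
    \<open>a n\<close>.\<close>
  define N where "N = a (n + 1) - smult (2 * \<gamma> * c) (a n)"
  have at_1: "poly (a n) 1 = (2 * \<gamma>) ^ n * poly (P n) (inverse \<gamma>)" for n
  proof -
    have "complex_of_real (poly (a n) 1) = of_real ((2 * \<gamma>) ^ n * poly (P n) (inverse \<gamma>))"
      using eval[of 1 n] by (simp add: poly_altdef inverse_eq_divide)
    then show ?thesis by (simp only: of_real_eq_iff)
  qed
  have "1 \<le> inverse \<gamma>"
    using gamma_pos gamma_le_1 by (simp add: one_le_inverse_iff)
  then have "poly (P n) (inverse \<gamma>) \<noteq> 0"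
    by (rule orth_interval_nonzero[OF weight P])
  then have "poly N 1 = 0"
    by (simp add: N_def at_1 c)
  then obtain S where S: "N = [:-1, 1:] * S"
    by (auto simp: poly_eq_0_iff_dvd dvd_def)
  have N_coeff: "coeff N i = (if i = n + 1 then 1 else 0)" if "n + 1 \<le> i" for i
    using that a[of "n + 1"] a[of n] by (auto simp: N_def coeff_eq_0)
  have degN: "degree N = n + 1"
  proof (rule antisym)
    show "degree N \<le> n + 1" by (rule degree_le) (simp add: N_coeff)
    show "n + 1 \<le> degree N" by (rule le_degree) (simp add: N_coeff)
  qed
  then have "lead_coeff N = 1"
    by (simp add: N_coeff)
  then have leadS: "lead_coeff S = 1"
    by (simp add: S lead_coeff_mult del: mult_pCons_left)
  then have "S \<noteq> 0" by auto
  then have degS: "degree S = n"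
    using degN by (simp add: S degree_mult_eq del: mult_pCons_left)
  have Seval: "(v\<^sup>2 - 1) * poly (cpoly S) (v\<^sup>2) = of_real ?K * (v ^ (n + 1) * of_real (poly (P (n + 1)) (Re v / \<gamma>)))
      - of_real (?K * c) * (v ^ n * of_real (poly (P n) (Re v / \<gamma>)))" if "norm v = 1" for v
  proof -
    have "(v\<^sup>2 - 1) * poly (cpoly S) (v\<^sup>2) = poly (cpoly N) (v\<^sup>2)"
      unfolding S cpoly_mult by (simp add: map_poly_pCons left_diff_distrib)
    also have "\<dots> = poly (cpoly (a (n + 1))) (v\<^sup>2) - of_real (2 * \<gamma> * c) * poly (cpoly (a n)) (v\<^sup>2)"
      by (simp only: N_def cpoly_diff cpoly_smult poly_diff poly_smult)
    finally show ?thesis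
      unfolding eval[OF that] by (simp add: mult_ac)
  qed
  let ?U = "int_chebyshev \<gamma>"
  \<comment> \<open>The index n - 2j is at most n in absolute value, so the integral with
    \<open>P (n + 1)\<close> vanishes. The one with \<open>P n\<close> survives only for j = n,
    where it gives the norm.\<close>
  have arc_form_S: "arc_form (cpoly S) (monom 1 j) =
      of_real (?K / 2 * (- c * (coeff (?U (int n - 1 - 2 * int j)) n * h n)))" if "j \<le> n" for j
  proof -
    have "arc_form (cpoly S) (cpoly (monom 1 j)) = of_real (weighted_integral w (\<lambda>x. ?K / 2 *
        (poly (P (n + 1)) x * poly (?U (int n - 2 * int j)) x
         - c * (poly (P n) x * poly (?U (int n - 1 - 2 * int j)) x))))"
      unfolding arc_form_cpoly
    proof (intro arg_cong[where f = of_real] weighted_integral_cong)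
      fix x :: real assume x: "x \<in> {-1<..<1}"
      have n: "norm (half_point \<gamma> x) = 1" using x by (intro norm_half_point) auto
      have "Im (half_point \<gamma> x) \<noteq> 0"
        using half_point_Im_pos[of \<gamma> x] x gamma_pos gamma_le_1 by simp
      from Re_quotient_kernel[OF n this Seval[OF n], of j]
      show "Re (poly (cpoly S) ((half_point \<gamma> x)\<^sup>2) * cnj (poly (cpoly (monom 1 j)) ((half_point \<gamma> x)\<^sup>2)))
          = ?K / 2 * (poly (P (n + 1)) x * poly (?U (int n - 2 * int j)) x
            - c * (poly (P n) x * poly (?U (int n - 1 - 2 * int j)) x))"
        unfolding Re_half_point_div by (simp add: map_poly_monom poly_monom)
    qed
    also have "weighted_integral w (\<lambda>x. ?K / 2 *
        (poly (P (n + 1)) x * poly (?U (int n - 2 * int j)) x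
         - c * (poly (P n) x * poly (?U (int n - 1 - 2 * int j)) x)))
       = ?K / 2 * (weighted_integral w (\<lambda>x. poly (P (n + 1)) x * poly (?U (int n - 2 * int j)) x)
         - c * weighted_integral w (\<lambda>x. poly (P n) x * poly (?U (int n - 1 - 2 * int j)) x))"
      unfolding weighted_integral_cmult
      by (subst weighted_integral_diff) (auto intro!: weight continuous_intros)
    also have "weighted_integral w (\<lambda>x. poly (P (n + 1)) x * poly (?U (int n - 2 * int j)) x) = 0"
      using that by (subst orth_interval_coeff[OF weight P]) (auto simp: coeff_int_chebyshev_eq_0)
    also have "weighted_integral w (\<lambda>x. poly (P n) x * poly (?U (int n - 1 - 2 * int j)) x)
        = coeff (?U (int n - 1 - 2 * int j)) n * h n"
      using that by (intro orth_interval_coeff[OF weight P]) (auto intro!: coeff_int_chebyshev_eq_0)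
    finally show ?thesis
      by (simp add: map_poly_monom)
  qed
  have mono: "monic_poly_seq (\<lambda>j. monom (1::complex) j)"
    by (simp add: monic_poly_seq_def degree_monom_eq)
  have "arc_form (cpoly S) (monom 1 j) = 0" if "j < n" for j
    using that by (simp add: arc_form_S coeff_int_chebyshev_eq_0)
  note unique = orth_circle_unique[OF \<Phi> mono _ _ this]
  have \<Phi>S: "\<Phi> n = cpoly S"
    using unique(1) degS leadS by simp
  show "(v\<^sup>2 - 1) * poly (\<Phi> n) (v\<^sup>2) = of_real ((2 * \<gamma>) ^ (n + 1)) * v ^ n *
           (v * of_real (poly (P (n + 1)) (Re v / \<gamma>)) - of_real (c * poly (P n) (Re v / \<gamma>)))"
    if "norm v = 1"
    unfolding \<Phi>S Seval[OF that] by (simp add: algebra_simps)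
  have "int n - 1 - 2 * int n = - int n - 1" by simp
  then have "coeff (?U (int n - 1 - 2 * int n)) n = - ((2 * \<gamma>) ^ n)"
    by (simp only: coeff_int_chebyshev_bottom)
  then have "arc_form (cpoly S) (monom 1 n) = of_real (?K / 2 * (c * ((2 * \<gamma>) ^ n * h n)))"
    unfolding arc_form_S[OF order_refl] by simp
  then have "complex_of_real (1 / (chi n)\<^sup>2) = of_real (\<gamma> / pi * (?K / 2 * (c * ((2 * \<gamma>) ^ n * h n))))"
    using unique(2) degS leadS by simp
  then have "1 / (chi n)\<^sup>2 = \<gamma> / pi * (?K / 2 * (c * ((2 * \<gamma>) ^ n * h n)))"
    by (simp only: of_real_eq_iff)
  also have "\<dots> = (2 * \<gamma>) ^ (2 * n) * (\<gamma>\<^sup>2 / pi) * c * h n"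
    by (simp add: power_even_eq power2_eq_square)
  finally show "1 / (chi n)\<^sup>2 = (2 * \<gamma>) ^ (2 * n) * (\<gamma>\<^sup>2 / pi) * c * h n" .
qed

section \<open>The representation through \<open>Q\<close>\<close>

text \<open>Conjugating v^2 - 1 gives -2 i (Im v) cnj v: the factor -i turns the real part into an
  imaginary part, and the Chebyshev formula supplies the second factor Im v.\<close>

lemma Re_shifted_kernel:
  assumes v: "norm v = 1"
  shows "Re (of_real K * v ^ k * of_real A * cnj ((v\<^sup>2) ^ j * (v\<^sup>2 - 1)))
    = 2 * K * (A * ((Im v)\<^sup>2 * poly (int_chebyshev \<gamma> (int k - 2 * int j - 1)) (Re v / \<gamma>)))"
proof -
  have "of_real K * v ^ k * of_real A * cnj ((v\<^sup>2) ^ j * (v\<^sup>2 - 1))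
      = - 2 * \<i> * of_real (K * A * Im v) * (v ^ k * cnj v ^ (2 * j + 1))"
    unfolding power2_minus_1_unit[OF v] by (simp add: power_mult[symmetric] mult_ac)
  also have "v ^ k * cnj v ^ (2 * j + 1) = v powi (int k - 2 * int j - 1)"
    unfolding power_mult_cnj_power[OF v] by (simp add: algebra_simps)
  also have "Re (- 2 * \<i> * of_real (K * A * Im v) * (v powi (int k - 2 * int j - 1)))
      = 2 * (K * A * Im v) * Im (v powi (int k - 2 * int j - 1))"
    by (simp add: mult.assoc)
  also have "\<dots> = 2 * K * (A * ((Im v)\<^sup>2 * poly (int_chebyshev \<gamma> (int k - 2 * int j - 1)) (Re v / \<gamma>)))"
    unfolding Im_powi_chebyshev[OF v gamma_pos[THEN less_imp_neq, symmetric]]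
    by (simp add: power2_eq_square)
  finally show ?thesis .
qed

lemma arc_moment_eq:
  "arc_moment w \<alpha> Q k = of_real (\<gamma> / pi) *
     circle_integral w \<gamma> (\<lambda>v. v ^ k * of_real (poly (Q k) (Re v / \<gamma>)))"
proof -
  let ?G = "\<lambda>v. v ^ k * complex_of_real (poly (Q k) (Re v / \<gamma>))"
  have "?G (cis (\<theta> / 2)) = cis (real k * \<theta> / 2) *
      complex_of_real (poly (Q k) (inverse (cos (\<alpha> / 2)) * cos (\<theta> / 2)))" for \<theta>
    unfolding Complex.DeMoivre times_divide_eq_right cis.sel divide_inverse[of _ \<gamma>] gamma[symmetric]
    by (simp only: mult.commute[of _ "inverse \<gamma>"])
  then have "arc_moment w \<alpha> Q k = complex_of_real (1 / (2 * pi)) * (LINT \<theta>:{\<alpha>..2*pi - \<alpha>}|lebesgue.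
          ?G (cis (\<theta> / 2)) * complex_of_real (arc_weight w \<alpha> \<theta>))"
    by (simp only: arc_moment_def)
  also have "\<dots> = complex_of_real (1 / (2 * pi)) * (of_real (2 * \<gamma>) * circle_integral w \<gamma> ?G)"
    using gamma_pos by (subst arc_integral) (auto intro!: continuous_intros)
  finally show ?thesis by simp
qed

text \<open>The added factor vanishes at most at x = 1/\<gamma> and x = -1/\<gamma>, which lie in
  the interval only when \<gamma> = 1.\<close>

lemma weight_second: "weight_on {-1..1} (\<lambda>x. w x * (1 - \<gamma>\<^sup>2 * x\<^sup>2))"
proof (rule weight_on_mult[OF weight])
  show "0 \<le> 1 - \<gamma>\<^sup>2 * x\<^sup>2" if "x \<in> {-1..1}" for x
    using half_point_norm(2)[OF _ that, of \<gamma>] gamma_pos gamma_le_1 by simp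
  have "{x\<in>{-1..1}. 1 - \<gamma>\<^sup>2 * x\<^sup>2 = 0} \<subseteq> {x. poly [:1, 0, - (\<gamma>\<^sup>2):] x = 0}"
    by (auto simp: power2_eq_square mult_ac)
  then show "finite {x\<in>{-1..1}. 1 - \<gamma>\<^sup>2 * x\<^sup>2 = 0}"
    by (rule finite_subset) (rule poly_roots_finite, simp)
qed (auto intro!: continuous_intros)

lemma second_representation:
  assumes Q: "monic_orth_interval (\<lambda>x. w x * (1 - \<gamma>\<^sup>2 * x\<^sup>2)) Q h'"
    and \<Phi>: "monic_orth_circle (arc_weight w \<alpha>) \<Phi> chi" and t: "t = arc_moment w \<alpha> Q"
  shows "norm v = 1 \<Longrightarrow> poly (\<Phi> (Suc n)) (v\<^sup>2) = of_real ((2 * \<gamma>) ^ Suc n) * v ^ Suc n *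
           (of_real (poly (Q (Suc n)) (Re v / \<gamma>))
            - cnj v * (t (Suc n) / t n) * of_real (poly (Q n) (Re v / \<gamma>)))"
    and "complex_of_real (1 / (chi (Suc n))\<^sup>2)
      = of_real ((2 * \<gamma>) ^ (2 * Suc n)) * (t (Suc n) / (of_real pi * t n)) * of_real (h' n)"
    and "complex_of_real (1 / (chi 0)\<^sup>2) = t 0"
proof -
  let ?W = "\<lambda>x. w x * (1 - \<gamma>\<^sup>2 * x\<^sup>2)" and ?U = "int_chebyshev \<gamma>"
  note monic = monic_poly_seqD[OF orth_intervalD(1)[OF Q]]
  have sym_second: "\<forall>x\<in>{-1..1}. ?W x = ?W (- x)"
    unfolding power2_minus by (intro ballI arg_cong[where f = "\<lambda>a. a * _"]) (rule even_weight[rule_format])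
  have "\<exists>a. degree a = n \<and> lead_coeff a = 1 \<and> (\<forall>v. norm v = 1 \<longrightarrow>
      poly (cpoly a) (v\<^sup>2) = of_real ((2 * \<gamma>) ^ n) * v ^ n * of_real (poly (Q n) (Re v / \<gamma>)))" for n
    using gamma_pos monic orth_interval_parity[OF weight_second Q sym_second]
    by (intro exists_half_power_poly) auto
  then obtain b where b: "\<And>n. degree (b n) = n" "\<And>n. lead_coeff (b n) = 1"
    and eval: "\<And>n v. norm v = 1 \<Longrightarrow> poly (cpoly (b n)) (v\<^sup>2)
      = of_real ((2 * \<gamma>) ^ n) * v ^ n * of_real (poly (Q n) (Re v / \<gamma>))"
    by metis
  define e where "e = (\<lambda>i. cpoly (case i of 0 \<Rightarrow> 1 | Suc j \<Rightarrow> monom 1 j * [:-1, 1:]))"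
  have e: "monic_poly_seq e"
    unfolding e_def by (rule monic_poly_seq_shifted_powers)
  \<comment> \<open>By (Im v)^2 = 1 - \<gamma>^2 x^2 the pairing becomes an integral of
    \<open>Q k\<close> for its own weight. The Chebyshev index k - 2j - 1 yields degree k only for j
    = k, so all earlier pairings vanish.\<close>
  have arc_form_b_Suc: "arc_form (cpoly (b k)) (e (Suc j))
      = of_real (2 * (2 * \<gamma>) ^ k * (coeff (?U (int k - 2 * int j - 1)) k * h' k))" if "j \<le> k" for j k
  proof -
    have "arc_form (cpoly (b k)) (e (Suc j)) = of_real (weighted_integral w (\<lambda>x. 2 * (2 * \<gamma>) ^ k *
        (poly (Q k) x * ((1 - \<gamma>\<^sup>2 * x\<^sup>2) * poly (?U (int k - 2 * int j - 1)) x))))"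
      unfolding e_def nat.case arc_form_cpoly
    proof (intro arg_cong[where f = of_real] weighted_integral_cong)
      fix x :: real assume x: "x \<in> {-1<..<1}"
      let ?v = "half_point \<gamma> x"
      have v: "norm ?v = 1" and "\<gamma>\<^sup>2 * x\<^sup>2 \<le> 1"
        using x half_point_norm[of \<gamma> x] gamma_pos gamma_le_1 by auto
      then have Im2: "(Im ?v)\<^sup>2 = 1 - \<gamma>\<^sup>2 * x\<^sup>2"
        by (simp add: Im_half_point)
      have "poly (cpoly (monom 1 j * [:-1, 1:])) (?v\<^sup>2) = (?v\<^sup>2) ^ j * (?v\<^sup>2 - 1)"
        unfolding cpoly_mult by (simp add: map_poly_monom map_poly_pCons poly_monom right_diff_distrib)
      then show "Re (poly (cpoly (b k)) (?v\<^sup>2) * cnj (poly (cpoly (monom 1 j * [:-1, 1:])) (?v\<^sup>2)))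
          = 2 * (2 * \<gamma>) ^ k * (poly (Q k) x * ((1 - \<gamma>\<^sup>2 * x\<^sup>2) * poly (?U (int k - 2 * int j - 1)) x))"
        by (simp only: eval[OF v] Re_shifted_kernel[OF v] Re_half_point_div Im2)
    qed
    also have "weighted_integral w (\<lambda>x. 2 * (2 * \<gamma>) ^ k *
        (poly (Q k) x * ((1 - \<gamma>\<^sup>2 * x\<^sup>2) * poly (?U (int k - 2 * int j - 1)) x)))
      = 2 * (2 * \<gamma>) ^ k * weighted_integral ?W (\<lambda>x. poly (Q k) x * poly (?U (int k - 2 * int j - 1)) x)"
      unfolding weighted_integral_cmult by (simp add: weighted_integral_def mult_ac)
    also have "weighted_integral ?W (\<lambda>x. poly (Q k) x * poly (?U (int k - 2 * int j - 1)) x)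
        = coeff (?U (int k - 2 * int j - 1)) k * h' k"
      using that by (intro orth_interval_coeff[OF weight_second Q]) (auto intro!: coeff_int_chebyshev_eq_0)
    finally show ?thesis .
  qed
  have arc_form_b_0: "of_real (\<gamma> / pi) * arc_form (cpoly (b k)) (e 0) = of_real ((2 * \<gamma>) ^ k) * t k" for k
  proof -
    have "arc_form (cpoly (b k)) (e 0) = circle_integral w \<gamma> (\<lambda>v. of_real ((2 * \<gamma>) ^ k) *
        (v ^ k * of_real (poly (Q k) (Re v / \<gamma>))))"
      unfolding arc_form_def by (rule circle_integral_cong) (simp add: eval e_def)
    then show ?thesis
      by (simp add: t arc_moment_eq)
  qed
  have arc_form_b_low: "arc_form (cpoly (b k)) (e (Suc j)) = 0" if "j < k" for j k
    using that by (simp add: arc_form_b_Suc coeff_int_chebyshev_eq_0)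
  have t_nonzero: "t k \<noteq> 0" for k
  proof
    assume "t k = 0"
    then have "arc_form (cpoly (b k)) (e 0) = 0"
      using arc_form_b_0[of k] gamma_pos by simp
    then have "arc_form (cpoly (b k)) (e i) = 0" if "i < Suc k" for i
      using that arc_form_b_low[of "i - 1" k] by (cases i) auto
    then have "arc_form (cpoly (b k)) (cpoly (b k)) = 0"
      by (rule arc_form_span_zero[OF e, where n = "Suc k"]) (auto simp: b(1) intro!: coeff_eq_0)
    moreover have "cpoly (b k) \<noteq> 0"
    proof
      assume "cpoly (b k) = 0"
      then have "complex_of_real (coeff (b k) k) = 0"
        by (metis coeff_0 coeff_cpoly)
      then show False using b[of k] by simp
    qed
    ultimately show False
      using arc_form_self_nonzero by blast
  qed
  define \<tau> where "\<tau> = t (Suc n) / t n"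
  \<comment> \<open>The quotient \<open>\<tau>\<close> cancels the pairing with \<open>e 0\<close>,
    the only one below \<open>e (Suc n)\<close> not already zero for both terms. It is a complex
    number here, so \<open>T\<close> is treated by linearity and not as an image under
    \<open>cpoly\<close>.\<close>
  define T where "T = cpoly (b (Suc n)) - smult (of_real (2 * \<gamma>) * \<tau>) (cpoly (b n))"
  have T_coeff: "coeff T i = (if i = Suc n then 1 else 0)" if "Suc n \<le> i" for i
    using that b[of "Suc n"] b[of n] by (auto simp: T_def coeff_eq_0)
  have degT: "degree T = Suc n"
  proof (rule antisym)
    show "degree T \<le> Suc n" by (rule degree_le) (simp add: T_coeff)
    show "Suc n \<le> degree T" by (rule le_degree) (simp add: T_coeff)
  qed
  then have leadT: "lead_coeff T = 1"
    by (simp add: T_coeff)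
  have arc_form_T: "arc_form T q = arc_form (cpoly (b (Suc n))) q - of_real (2 * \<gamma>) * \<tau> * arc_form (cpoly (b n)) q" for q
    unfolding T_def arc_form_diff_left arc_form_smult_left ..
  have "arc_form T (e i) = 0" if "i < Suc n" for i
  proof (cases i)
    case 0
    have "of_real (\<gamma> / pi) * arc_form T (e i)
        = of_real (\<gamma> / pi) * arc_form (cpoly (b (Suc n))) (e i)
          - of_real (2 * \<gamma>) * \<tau> * (of_real (\<gamma> / pi) * arc_form (cpoly (b n)) (e i))"
      unfolding arc_form_T by (simp only: right_diff_distrib mult_ac)
    also have "\<dots> = 0"
      unfolding 0 arc_form_b_0 using t_nonzero[of n] by (simp add: \<tau>_def)
    finally show ?thesis using gamma_pos by simp
  next
    case (Suc j)
    then show ?thesis using that by (simp add: arc_form_T arc_form_b_low)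
  qed
  note unique = orth_circle_unique[OF \<Phi> e degT leadT this]
  show "poly (\<Phi> (Suc n)) (v\<^sup>2) = of_real ((2 * \<gamma>) ^ Suc n) * v ^ Suc n *
           (of_real (poly (Q (Suc n)) (Re v / \<gamma>))
            - cnj v * (t (Suc n) / t n) * of_real (poly (Q n) (Re v / \<gamma>)))" if v: "norm v = 1"
  proof -
    have "v * cnj v = 1"
      using v by (metis complex_norm_square of_real_1 power_one)
    \<comment> \<open>The inserted v * cnj v raises v^n to the common factor v^(n+1) and leaves cnj
      v, which is z^(-1/2).\<close>
    have "poly (\<Phi> (Suc n)) (v\<^sup>2) = poly (cpoly (b (Suc n))) (v\<^sup>2)
        - of_real (2 * \<gamma>) * \<tau> * ((v * cnj v) * poly (cpoly (b n)) (v\<^sup>2))"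
      unfolding \<open>v * cnj v = 1\<close> by (simp add: unique(1) T_def)
    also have "\<dots> = of_real ((2 * \<gamma>) ^ Suc n) * v ^ Suc n *
           (of_real (poly (Q (Suc n)) (Re v / \<gamma>)) - cnj v * \<tau> * of_real (poly (Q n) (Re v / \<gamma>)))"
      unfolding eval[OF v] power_Suc of_real_mult by (simp only: right_diff_distrib mult_ac)
    finally show ?thesis by (simp only: \<tau>_def)
  qed
  have shift: "int n - 2 * int n - 1 = - int n - 1" by simp
  \<comment> \<open>Only the \<open>Q n\<close> term survives; its minus sign cancels that of the
    Chebyshev coefficient.\<close>
  have "arc_form T (e (Suc n)) = of_real (2 * \<gamma>) * \<tau> * of_real (2 * (2 * \<gamma>) ^ n * ((2 * \<gamma>) ^ n * h' n))"
    unfolding arc_form_T arc_form_b_low[OF lessI] arc_form_b_Suc[OF order_refl] shift coeff_int_chebyshev_bottom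
    by simp
  then have "complex_of_real (1 / (chi (Suc n))\<^sup>2)
      = of_real (\<gamma> / pi) * (of_real (2 * \<gamma>) * \<tau> * of_real (2 * (2 * \<gamma>) ^ n * ((2 * \<gamma>) ^ n * h' n)))"
    using unique(2) by simp
  also have "\<dots> = of_real (\<gamma> / pi * (2 * \<gamma>) * (2 * (2 * \<gamma>) ^ n * ((2 * \<gamma>) ^ n))) * \<tau> * of_real (h' n)"
    by (simp only: of_real_mult mult_ac)
  also have "\<gamma> / pi * (2 * \<gamma>) * (2 * (2 * \<gamma>) ^ n * ((2 * \<gamma>) ^ n)) = (2 * \<gamma>) ^ (2 * Suc n) / pi"
    by (simp add: power_even_eq power2_eq_square)
  finally show "complex_of_real (1 / (chi (Suc n))\<^sup>2)
      = of_real ((2 * \<gamma>) ^ (2 * Suc n)) * (t (Suc n) / (of_real pi * t n)) * of_real (h' n)"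
    by (simp add: \<tau>_def)
  have "degree (b 0) = 0" "coeff (b 0) 0 = 1"
    using b(1,2)[of 0] by simp_all
  then have "degree (cpoly (b 0)) = 0" "lead_coeff (cpoly (b 0)) = 1"
    by simp_all
  \<comment> \<open>In degree zero there are no orthogonality conditions, and the pairing with
    \<open>e 0 = 1\<close> is \<open>t 0\<close> itself.\<close>
  from orth_circle_unique(2)[OF \<Phi> e this] show "complex_of_real (1 / (chi 0)\<^sup>2) = t 0"
    using arc_form_b_0[of 0] by simp
qed

end

section \<open>Both representations in terms of the angle \<theta>\<close>

theorem lemma2p1:
  fixes w :: "real \<Rightarrow> real" and \<alpha> \<gamma> :: real
    and P Q :: "nat \<Rightarrow> real poly" and h h' :: "nat \<Rightarrow> real"
    and \<Phi> :: "nat \<Rightarrow> complex poly" and chi :: "nat \<Rightarrow> real" and t :: "nat \<Rightarrow> complex"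
  assumes "weight_on {-1..1} w"
    and "\<forall>x\<in>{-1..1}. w x = w (- x)"
    and "0 \<le> \<alpha>" and "\<alpha> < pi" and "\<gamma> = cos (\<alpha> / 2)"
    and "monic_orth_interval w P h"
    and "monic_orth_interval (\<lambda>x. w x * (1 - \<gamma>\<^sup>2 * x\<^sup>2)) Q h'"
    and "monic_orth_circle (arc_weight w \<alpha>) \<Phi> chi"
    and "t = arc_moment w \<alpha> Q"
  shows
    "(\<forall>n.
        (\<forall>\<theta>\<in>{0..2*pi}. let x = inverse \<gamma> * cos (\<theta> / 2) in
           cis \<theta> \<noteq> 1 \<longrightarrow>
           poly (\<Phi> n) (cis \<theta>) =
             complex_of_real ((2 * \<gamma>) ^ (n + 1)) * cis (real n * \<theta> / 2) / (cis \<theta> - 1) *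
             (cis (\<theta> / 2) * complex_of_real (poly (P (n + 1)) x)
              - complex_of_real (poly (P (n + 1)) (inverse \<gamma>) / poly (P n) (inverse \<gamma>)
                                 * poly (P n) x))) \<and>
        1 / (chi n)\<^sup>2 =
          (2 * \<gamma>) ^ (2 * n) * (\<gamma>\<^sup>2 / pi) *
          (poly (P (n + 1)) (inverse \<gamma>) / poly (P n) (inverse \<gamma>)) * h n) \<and>
     (\<forall>n\<ge>1.
        (\<forall>\<theta>\<in>{0..2*pi}. let x = inverse \<gamma> * cos (\<theta> / 2) in
           poly (\<Phi> n) (cis \<theta>) =
             complex_of_real ((2 * \<gamma>) ^ n) * cis (real n * \<theta> / 2) *
             (complex_of_real (poly (Q n) x)
              - cis (- \<theta> / 2) * (t n / t (n - 1)) * complex_of_real (poly (Q (n - 1)) x))) \<and>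
        complex_of_real (1 / (chi n)\<^sup>2) =
          complex_of_real ((2 * \<gamma>) ^ (2 * n)) * (t n / (complex_of_real pi * t (n - 1))) *
          complex_of_real (h' (n - 1))) \<and>
     complex_of_real (1 / (chi 0)\<^sup>2) = t 0"
proof -
  interpret symmetric_arc w \<alpha> \<gamma>
    by (rule symmetric_arc.intro) (fact assms)+
  note first = first_representation[OF assms(6,8) refl]
    and second = second_representation[OF assms(7,8,9)]
  \<comment> \<open>Specialising to \<open>v = cis (\<theta> / 2)\<close> realises the required
    branch of the half-integer powers.\<close>
  have half: "(cis (\<theta> / 2))\<^sup>2 = cis \<theta>" "Re (cis (\<theta> / 2)) / \<gamma> = inverse \<gamma> * cos (\<theta> / 2)"
    "cis (\<theta> / 2) ^ n = cis (real n * \<theta> / 2)" "cnj (cis (\<theta> / 2)) = cis (- \<theta> / 2)" for \<theta> n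
    by (simp_all add: power2_eq_square cis_mult Complex.DeMoivre divide_inverse[of _ \<gamma>]
        mult.commute[of _ "inverse \<gamma>"] cis_cnj)
  show ?thesis
  proof (intro conjI allI impI ballI)
    fix n :: nat and \<theta> :: real
    show "let x = inverse \<gamma> * cos (\<theta> / 2) in cis \<theta> \<noteq> 1 \<longrightarrow>
           poly (\<Phi> n) (cis \<theta>) =
             complex_of_real ((2 * \<gamma>) ^ (n + 1)) * cis (real n * \<theta> / 2) / (cis \<theta> - 1) *
             (cis (\<theta> / 2) * complex_of_real (poly (P (n + 1)) x)
              - complex_of_real (poly (P (n + 1)) (inverse \<gamma>) / poly (P n) (inverse \<gamma>)
                                 * poly (P n) x))"
      unfolding Let_def
    proof
      assume "cis \<theta> \<noteq> 1"
      then have nz: "cis \<theta> - 1 \<noteq> 0" by simp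
      have cancel: "p = a / d * b" if "d * p = a * b" "d \<noteq> 0" for p a b d :: complex
        using that by (simp add: field_simps)
      show "poly (\<Phi> n) (cis \<theta>) =
             complex_of_real ((2 * \<gamma>) ^ (n + 1)) * cis (real n * \<theta> / 2) / (cis \<theta> - 1) *
             (cis (\<theta> / 2) * complex_of_real (poly (P (n + 1)) (inverse \<gamma> * cos (\<theta> / 2)))
              - complex_of_real (poly (P (n + 1)) (inverse \<gamma>) / poly (P n) (inverse \<gamma>)
                                 * poly (P n) (inverse \<gamma> * cos (\<theta> / 2))))"
        using first(1)[of "cis (\<theta> / 2)" n] unfolding half norm_cis by (intro cancel nz) simp
    qed
  next
    fix n :: nat
    show "1 / (chi n)\<^sup>2 = (2 * \<gamma>) ^ (2 * n) * (\<gamma>\<^sup>2 / pi) *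
          (poly (P (n + 1)) (inverse \<gamma>) / poly (P n) (inverse \<gamma>)) * h n"
      by (rule first(2))
  next
    fix n :: nat and \<theta> :: real assume "1 \<le> n"
    then obtain m where n: "n = Suc m" by (cases n) auto
    show "let x = inverse \<gamma> * cos (\<theta> / 2) in
           poly (\<Phi> n) (cis \<theta>) =
             complex_of_real ((2 * \<gamma>) ^ n) * cis (real n * \<theta> / 2) *
             (complex_of_real (poly (Q n) x)
              - cis (- \<theta> / 2) * (t n / t (n - 1)) * complex_of_real (poly (Q (n - 1)) x))"
      using second(1)[of "cis (\<theta> / 2)" m] unfolding half norm_cis n Let_def diff_Suc_1 by simp
  next
    fix n :: nat assume "1 \<le> n"
    then obtain m where n: "n = Suc m" by (cases n) auto
    show "complex_of_real (1 / (chi n)\<^sup>2) =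
          complex_of_real ((2 * \<gamma>) ^ (2 * n)) * (t n / (complex_of_real pi * t (n - 1))) *
          complex_of_real (h' (n - 1))"
      unfolding n diff_Suc_1 by (rule second(2))
  qed (rule second(3))
qed

end
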